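(* There is an absolute constant $c$ such that for every decreasing function $f\colon (0,1) \rightarrow \mathbb{N}$ satisfying $f(x) \geq 1/x$, there is a monotone graph property $\mathcal{P}$ satisfying $$f(\varepsilon) \leq w_{\mathcal{P}}(\varepsilon) \leq \varepsilon^{-14} f(\varepsilon/c).$$
   Context: A graph property is monotone if it is closed under removal of vertices and edges. An $n$-vertex graph $G$ is $\varepsilon$-far from $\mathcal{P}$ if one must remove at least $\varepsilon n^2$ edges from $G$ to make it satisfy $\mathcal{P}$. For a monotone graph property $\mathcal{P}$ and $\varepsilon\in(0,1)$, $w_{\mathcal{P}}(\varepsilon)$ is the smallest positive integer $w$ such that for every sufficiently large graph $G$ which is $\varepsilon$-far from satisfying $\mathcal{P}$, a uniformly random set $S$ of $w$ vertices of $G$ is such that the induced subgraph $G[S]$ does not satisfy $\mathcal{P}$ with probability at least $2/3$. (It is known that $w_{\mathcal{P}}(\varepsilon)$ is well-defined for every monotone graph property $\mathcal{P}$.)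
   Formalization: The lower bound f(ε) ≤ w_P(ε) is stated only for ε in (0,1/4), since over all of (0,1) it is false (for ε ≥ 1/2 no graph is ε-far once P contains all edgeless graphs, so w_P(ε)=1 < f(ε)); the upper bound is stated for all ε in (0,1). *)

theory Defs
  imports "HOL-Probability.Probability"
begin

text \<open>Finite simple graphs, as pairs of a vertex set and a set of two-element edges. Every finite
  graph has an isomorphic copy on natural numbers, so taking vertices in \<^typ>\<open>nat\<close> loses nothing
  for isomorphism-invariant properties.\<close>

type_synonym graph = "nat set \<times> nat set set"

abbreviation verts :: "graph \<Rightarrow> nat set" where "verts \<equiv> fst"
abbreviation edges :: "graph \<Rightarrow> nat set set" where "edges \<equiv> snd"

definition simple_graph :: "graph \<Rightarrow> bool" where
  "simple_graph G \<longleftrightarrow> finite (verts G) \<and> (\<forall>e\<in>edges G. e \<subseteq> verts G \<and> card e = 2)"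

definition graph_isomorphic :: "graph \<Rightarrow> graph \<Rightarrow> bool" where
  "graph_isomorphic G H \<longleftrightarrow>
     (\<exists>h. bij_betw h (verts G) (verts H) \<and> edges H = (\<lambda>e. h ` e) ` edges G)"

definition induced_subgraph :: "graph \<Rightarrow> nat set \<Rightarrow> graph" where
  "induced_subgraph G S = (S, {e \<in> edges G. e \<subseteq> S})"

definition remove_edges :: "graph \<Rightarrow> nat set set \<Rightarrow> graph" where
  "remove_edges G D = (verts G, edges G - D)"

definition graph_property :: "graph set \<Rightarrow> bool" where
  "graph_property P \<longleftrightarrow> (\<forall>G\<in>P. simple_graph G) \<and>
     (\<forall>G H. G \<in> P \<longrightarrow> simple_graph H \<longrightarrow> graph_isomorphic G H \<longrightarrow> H \<in> P)"

definition monotone_graph_property :: "graph set \<Rightarrow> bool" where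
  "monotone_graph_property P \<longleftrightarrow> graph_property P \<and>
     (\<forall>G\<in>P. \<forall>v\<in>verts G. induced_subgraph G (verts G - {v}) \<in> P) \<and>
     (\<forall>G\<in>P. \<forall>e\<in>edges G. remove_edges G {e} \<in> P)"

definition eps_far :: "real \<Rightarrow> graph set \<Rightarrow> graph \<Rightarrow> bool" where
  "eps_far \<epsilon> P G \<longleftrightarrow>
     (\<forall>D \<subseteq> edges G. remove_edges G D \<in> P \<longrightarrow> real (card D) \<ge> \<epsilon> * real (card (verts G)) ^ 2)"

text \<open>The probability below is junk if \<open>w > card (verts G)\<close>; this is harmless wherever \<open>G\<close> is
  required to be sufficiently large.\<close>

definition rejection_prob :: "graph set \<Rightarrow> graph \<Rightarrow> nat \<Rightarrow> real" where
  "rejection_prob P G w =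
     measure_pmf.prob (pmf_of_set {S. S \<subseteq> verts G \<and> card S = w}) {S. induced_subgraph G S \<notin> P}"

definition sample_size_suffices :: "graph set \<Rightarrow> real \<Rightarrow> nat \<Rightarrow> bool" where
  "sample_size_suffices P \<epsilon> w \<longleftrightarrow>
     (\<exists>N. \<forall>G. simple_graph G \<longrightarrow> card (verts G) \<ge> N \<longrightarrow> eps_far \<epsilon> P G \<longrightarrow>
        rejection_prob P G w \<ge> 2 / 3)"

definition witness_size :: "graph set \<Rightarrow> real \<Rightarrow> nat" where
  "witness_size P \<epsilon> = (LEAST w. w > 0 \<and> sample_size_suffices P \<epsilon> w)"

end

theory Submission
  imports Defs
begin

text \<open>The property is: no closed walk of odd length \<open>k\<close> once the graph has \<open>f(1/(k+2)\<^sup>2)\<close> vertices.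

  If \<open>1/(\<ell>+2)\<^sup>2 \<le> \<epsilon> < 1/\<ell>\<^sup>2\<close> with \<open>\<ell>\<close> odd, large blow-ups of the cycle of length \<open>\<ell>\<close> are \<open>\<epsilon>\<close>-far,
  since they contain \<open>(n/\<ell>)\<^sup>2\<close> edge-disjoint \<open>\<ell>\<close>-cycles, but have no shorter odd closed walk, so samples of
  fewer than \<open>f(\<epsilon>)\<close> vertices satisfy the property. For \<open>1/9 \<le> \<epsilon> < 1/4\<close> complete graphs serve instead.

  Conversely, a graph that is \<open>\<epsilon>\<close>-far is far from bipartite, and it suffices that a sample of
  polynomial size contains an odd closed walk of length \<open>O(1/sqrt \<epsilon>)\<close>. Explore balls in which every
  vertex of a layer has \<open>\<delta> n\<close> neighbours in the previous layer, \<open>\<delta> = \<epsilon>\<^sup>3/200\<close>. If within that radius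
  hardly any vertex sees a layer with many internal edges, repeatedly cutting off a ball with thin
  boundary and colouring it by the parity of the layers shows that the graph is close to bipartite.
  Otherwise a sample contains such a vertex and an edge in one of its layers, and whp it meets all of
  the linear-sized neighbourhoods needed to walk back from both ends of the edge.\<close>

text \<open>Edges become a symmetric relation, so that walks of length \<open>k\<close> are
  relational powers. A closed walk, unlike a cycle, may repeat vertices; in a simple graph none has
  length 1, as singletons are not edges.\<close>

definition arcs :: "'a set set \<Rightarrow> ('a \<times> 'a) set" where
  "arcs E = {(x, y). {x, y} \<in> E}"

lemma arcs_iff [simp]: "(x, y) \<in> arcs E \<longleftrightarrow> {x, y} \<in> E"
  by (simp add: arcs_def)

lemma relpow_hom:
  fixes r :: "('a \<times> 'a) set" and s :: "('b \<times> 'b) set"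
  assumes "(x, y) \<in> r ^^ k" "\<And>a b. (a, b) \<in> r \<Longrightarrow> (h a, h b) \<in> s"
  shows "(h x, h y) \<in> s ^^ k"
  using assms(1)
proof (induction k arbitrary: y)
  case (Suc k)
  then obtain z where "(x, z) \<in> r ^^ k" "(z, y) \<in> r" by auto
  then show ?case using Suc.IH assms(2) by (meson relpow_Suc_I)
qed auto

lemma relpow_mono_rel:
  fixes r s :: "('a \<times> 'a) set"
  assumes "(x, y) \<in> r ^^ k" "r \<subseteq> s"
  shows "(x, y) \<in> s ^^ k"
  using relpow_hom[of x y k r id s] assms by auto

lemma arcs_relpow_sym:
  assumes "(x, y) \<in> arcs E ^^ k"
  shows "(y, x) \<in> arcs E ^^ k"
  using assms
proof (induction k arbitrary: y)
  case (Suc k)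
  then obtain z where "(x, z) \<in> arcs E ^^ k" "(z, y) \<in> arcs E" by auto
  then show ?case using Suc.IH by (metis arcs_iff insert_commute relpow_Suc_I2)
qed auto

lemma two_coloured_walk_parity:
  assumes "(x, y) \<in> arcs E ^^ k" "\<And>u v. {u, v} \<in> E \<Longrightarrow> col u \<noteq> (col v :: bool)"
  shows "col y = (col x \<noteq> odd k)"
  using assms(1)
proof (induction k arbitrary: y)
  case (Suc k)
  then obtain z where "(x, z) \<in> arcs E ^^ k" "{z, y} \<in> E" by auto
  then show ?case using Suc.IH[of z] assms(2)[of z y] by auto
qed auto

lemma finite_edges: "simple_graph G \<Longrightarrow> finite (edges G)"
  unfolding simple_graph_def by (rule finite_subset[of _ "Pow (verts G)"]) auto

section \<open>Graphs without short odd closed walks\<close>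

text \<open>For increasing \<open>g\<close> the property says that the odd girth exceeds a slowly growing function of
  the number of vertices.\<close>

definition slow_odd_girth :: "(nat \<Rightarrow> nat) \<Rightarrow> graph set" where
  "slow_odd_girth g = {G. simple_graph G \<and>
     (\<forall>k v. odd k \<longrightarrow> g k \<le> card (verts G) \<longrightarrow> (v, v) \<notin> arcs (edges G) ^^ k)}"

text \<open>Fewer vertices activate fewer lengths \<open>k\<close>, and fewer edges leave fewer
  closed walks.\<close>

lemma slow_odd_girth_subgraph:
  assumes G: "G \<in> slow_odd_girth g" and H: "simple_graph H"
    and sub: "verts H \<subseteq> verts G" "edges H \<subseteq> edges G"
  shows "H \<in> slow_odd_girth g"
proof -
  have "card (verts H) \<le> card (verts G)"
    using G sub by (auto simp: slow_odd_girth_def simple_graph_def intro: card_mono)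
  moreover have "arcs (edges H) \<subseteq> arcs (edges G)" using sub by auto
  ultimately have "(v, v) \<notin> arcs (edges H) ^^ k" if "odd k" "g k \<le> card (verts H)" for k v
    using G that relpow_mono_rel[of v v k "arcs (edges H)" "arcs (edges G)"]
    by (force simp: slow_odd_girth_def)
  then show ?thesis using H by (simp add: slow_odd_girth_def)
qed

lemma slow_odd_girth_isomorphic:
  assumes G: "G \<in> slow_odd_girth g" and H: "simple_graph H" and iso: "graph_isomorphic G H"
  shows "H \<in> slow_odd_girth g"
proof -
  obtain h where h: "bij_betw h (verts G) (verts H)" "edges H = (\<lambda>e. h ` e) ` edges G"
    using iso unfolding graph_isomorphic_def by auto
  define k where "k = inv_into (verts G) h"
  have sG: "simple_graph G" using G by (simp add: slow_odd_girth_def)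
  have hom: "(k a, k b) \<in> arcs (edges G)" if "(a, b) \<in> arcs (edges H)" for a b
  proof -
    have "{a, b} \<in> (\<lambda>e. h ` e) ` edges G" using that h(2) by simp
    then obtain e where e: "e \<in> edges G" "{a, b} = h ` e" by blast
    have "e \<subseteq> verts G" using e sG by (auto simp: simple_graph_def)
    then have "k ` (h ` e) = e" unfolding k_def
      using h(1) by (metis bij_betw_imp_inj_on inv_into_image_cancel)
    then have "{k a, k b} = e" unfolding e(2)[symmetric] by simp
    then show ?thesis using e(1) by simp
  qed
  have "card (verts G) = card (verts H)" using h(1) bij_betw_same_card by blast
  moreover have "(k v, k v) \<in> arcs (edges G) ^^ i" if "(v, v) \<in> arcs (edges H) ^^ i" for i v
    using relpow_hom[OF that hom] .
  moreover have "(v, v) \<notin> arcs (edges G) ^^ i" if "odd i" "g i \<le> card (verts G)" for i v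
    using G that by (simp add: slow_odd_girth_def)
  ultimately have "(v, v) \<notin> arcs (edges H) ^^ i" if "odd i" "g i \<le> card (verts H)" for i v
    using that by metis
  then show ?thesis using H by (simp add: slow_odd_girth_def)
qed

lemma monotone_slow_odd_girth: "monotone_graph_property (slow_odd_girth g)"
proof -
  have simp: "simple_graph G" if "G \<in> slow_odd_girth g" for G
    using that by (simp add: slow_odd_girth_def)
  have "induced_subgraph G (verts G - {v}) \<in> slow_odd_girth g" if "G \<in> slow_odd_girth g" for G v
    using simp[OF that] by (intro slow_odd_girth_subgraph[OF that])
      (auto simp: induced_subgraph_def simple_graph_def)
  moreover have "remove_edges G {e} \<in> slow_odd_girth g" if "G \<in> slow_odd_girth g" for G e
    using simp[OF that] by (intro slow_odd_girth_subgraph[OF that])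
      (auto simp: remove_edges_def simple_graph_def)
  ultimately show ?thesis
    using simp slow_odd_girth_isomorphic
    unfolding monotone_graph_property_def graph_property_def by blast
qed

section \<open>Rejection probability by counting samples\<close>

lemma rejection_prob_eq:
  assumes "simple_graph G" "w \<le> card (verts G)"
  shows "rejection_prob P G w =
    real (card {S. S \<subseteq> verts G \<and> card S = w \<and> induced_subgraph G S \<notin> P}) / real (card (verts G) choose w)"
proof -
  let ?A = "{S. S \<subseteq> verts G \<and> card S = w}"
  have fin: "finite (verts G)" using assms by (simp add: simple_graph_def)
  have "?A \<noteq> {}" using assms(2) by (metis (mono_tags, lifting) empty_Collect_eq obtain_subset_with_card_n)
  then have "rejection_prob P G w = card (?A \<inter> {S. induced_subgraph G S \<notin> P}) / card ?A"
    unfolding rejection_prob_def by (intro measure_pmf_of_set) (use fin in auto)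
  also have "?A \<inter> {S. induced_subgraph G S \<notin> P} = {S. S \<subseteq> verts G \<and> card S = w \<and> induced_subgraph G S \<notin> P}"
    by auto
  finally show ?thesis by (simp add: n_subsets[OF fin])
qed

text \<open>As \<open>g\<close> is nondecreasing, a sample of \<open>w < g l\<close> vertices
  activates only lengths below \<open>l\<close>. The graphs supplied by \<open>far\<close> have no
  odd closed walks of these lengths, so every sample satisfies the property.\<close>

lemma not_sample_size_suffices:
  assumes mono: "\<And>i j. i \<le> j \<Longrightarrow> g i \<le> g j" and w: "w < g l"
    and far: "\<And>N. \<exists>G. simple_graph G \<and> N \<le> card (verts G) \<and> eps_far \<epsilon> (slow_odd_girth g) G
        \<and> (\<forall>k v. odd k \<longrightarrow> k < l \<longrightarrow> (v, v) \<notin> arcs (edges G) ^^ k)"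
  shows "\<not> sample_size_suffices (slow_odd_girth g) \<epsilon> w"
proof
  assume "sample_size_suffices (slow_odd_girth g) \<epsilon> w"
  then obtain N where N: "\<And>G. simple_graph G \<Longrightarrow> card (verts G) \<ge> N \<Longrightarrow> eps_far \<epsilon> (slow_odd_girth g) G \<Longrightarrow>
        rejection_prob (slow_odd_girth g) G w \<ge> 2 / 3"
    unfolding sample_size_suffices_def by blast
  \<comment> \<open>Taking \<open>max N w\<close> ensures that sets of \<open>w\<close> vertices
    exist.\<close>
  obtain G where G: "simple_graph G" "max N w \<le> card (verts G)" "eps_far \<epsilon> (slow_odd_girth g) G"
    "\<And>k v. odd k \<Longrightarrow> k < l \<Longrightarrow> (v, v) \<notin> arcs (edges G) ^^ k" using far by blast
  have "induced_subgraph G S \<in> slow_odd_girth g" if S: "S \<subseteq> verts G" "card S = w" for S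
  proof -
    have "finite S" using S G(1) by (auto simp: simple_graph_def intro: finite_subset)
    then have "simple_graph (induced_subgraph G S)" using G(1) by (auto simp: induced_subgraph_def simple_graph_def)
    moreover have "(v, v) \<notin> arcs (edges (induced_subgraph G S)) ^^ k" if "odd k" "g k \<le> w" for k v
    proof -
      have "k < l" using mono[of l k] w that(2) by (meson le_less_trans not_le)
      moreover have "arcs (edges (induced_subgraph G S)) \<subseteq> arcs (edges G)"
        by (auto simp: induced_subgraph_def)
      ultimately show ?thesis using G(4)[OF that(1), of v]
          relpow_mono_rel[of v v k "arcs (edges (induced_subgraph G S))" "arcs (edges G)"]
        by blast
    qed
    ultimately show ?thesis using S by (auto simp: slow_odd_girth_def induced_subgraph_def)
  qed
  then have "{S. S \<subseteq> verts G \<and> card S = w \<and> induced_subgraph G S \<notin> slow_odd_girth g} = {}" by blast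
  then have "rejection_prob (slow_odd_girth g) G w = 0"
    using rejection_prob_eq[OF G(1), of w] G(2) by (simp only:) simp
  with N[OF G(1) _ G(3)] G(2) show False by simp
qed

section \<open>Far graphs of large odd girth\<close>

text \<open>Mantel's bound. The neighbourhood of a vertex \<open>v\<close> of maximal degree is
  independent, so every edge has an end outside \<open>N v\<close>, and each such end lies in at
  most \<open>card (N v)\<close> edges.\<close>

lemma triangle_free_edge_bound:
  assumes G: "simple_graph G" and tri: "\<And>v. (v, v) \<notin> arcs (edges G) ^^ 3"
  shows "4 * card (edges G) \<le> card (verts G) ^ 2"
proof (cases "verts G = {}")
  case True
  then have "edges G = {}" using G by (auto simp: simple_graph_def)
  then show ?thesis by simp
next
  case False
  define N where "N u = {x \<in> verts G. {u, x} \<in> edges G}" for u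
  have fin: "finite (verts G)" using G by (simp add: simple_graph_def)
  have finN: "finite (N u)" for u using fin by (simp add: N_def)
  obtain v where v: "v \<in> verts G" and Max_v: "Max ((\<lambda>u. card (N u)) ` verts G) = card (N v)"
    using obtains_MAX[OF fin False] by blast
  have max: "card (N u) \<le> card (N v)" if "u \<in> verts G" for u
    unfolding Max_v[symmetric] using fin that by (intro Max_ge) auto
  let ?C = "verts G - N v"
  have "edges G \<subseteq> (\<Union>u\<in>?C. (\<lambda>x. {u, x}) ` N u)"
  proof
    fix e assume e: "e \<in> edges G"
    then have "card e = 2" "e \<subseteq> verts G" using G by (auto simp: simple_graph_def)
    then obtain x y where xy: "e = {x, y}" "x \<in> verts G" "y \<in> verts G"
      by (auto simp: card_2_iff)
    have yx: "{y, x} = {x, y}" "{y, v} = {v, y}" by blast+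
    have nbr: "y \<in> N x" "x \<in> N y" using e xy yx by (auto simp: N_def)
    have "\<not> (x \<in> N v \<and> y \<in> N v)"
    proof
      assume "x \<in> N v \<and> y \<in> N v"
      then have "(v, x) \<in> arcs (edges G)" "(x, y) \<in> arcs (edges G)" "(y, v) \<in> arcs (edges G)"
        using e xy yx by (simp_all add: N_def)
      then have "(v, v) \<in> arcs (edges G) ^^ Suc (Suc (Suc 0))"
        by (intro relpow_Suc_I) auto
      moreover have "Suc (Suc (Suc 0)) = 3" by simp
      ultimately show False using tri[of v] by metis
    qed
    then consider "x \<in> ?C" | "y \<in> ?C" using xy by blast
    then show "e \<in> (\<Union>u\<in>?C. (\<lambda>x. {u, x}) ` N u)"
    proof cases
      case 1
      then show ?thesis using xy(1) nbr(1) by blast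
    next
      case 2
      then show ?thesis using xy(1) yx(1) nbr(2) by (intro UN_I[of y]) auto
    qed
  qed
  then have "card (edges G) \<le> card (\<Union>u\<in>?C. (\<lambda>x. {u, x}) ` N u)"
    using fin finN by (intro card_mono) auto
  also have "\<dots> \<le> (\<Sum>u\<in>?C. card ((\<lambda>x. {u, x}) ` N u))"
    using fin by (intro card_UN_le) auto
  also have "\<dots> \<le> (\<Sum>u\<in>?C. card (N v))"
    using max by (intro sum_mono order.trans[OF card_image_le[OF finN]]) auto
  also have "\<dots> = (card (verts G) - card (N v)) * card (N v)"
    using card_Diff_subset[OF finN, of v "verts G"] by (simp add: N_def)
  finally have le: "card (edges G) \<le> (card (verts G) - card (N v)) * card (N v)" .
  have sub: "card (N v) \<le> card (verts G)" using fin by (auto simp: N_def intro: card_mono)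
  have "4 * ((a - b) * b) \<le> a ^ 2" if "b \<le> a" for a b :: nat
  proof -
    obtain d where d: "a = b + d" using \<open>b \<le> a\<close> le_Suc_ex by blast
    have "0 \<le> (int b - int d) ^ 2" by simp
    then have "int (4 * (d * b)) \<le> int ((b + d) ^ 2)" by (simp add: power2_eq_square algebra_simps)
    then have "4 * (d * b) \<le> (b + d) ^ 2" by (simp only: of_nat_le_iff)
    then show ?thesis by (simp add: d)
  qed
  then show ?thesis using mult_le_mono2[OF le, of 4] sub by (meson order_trans)
qed

text \<open>By Mantel's bound a complete graph must lose about \<open>n^2/2 - n^2/4\<close> edges to
  become triangle-free.\<close>

lemma complete_graph_far:
  assumes "\<epsilon> < 1/4"
  shows "\<exists>G. simple_graph G \<and> N \<le> card (verts G) \<and> eps_far \<epsilon> (slow_odd_girth g) G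
        \<and> (\<forall>k v. odd k \<longrightarrow> k < 3 \<longrightarrow> (v, v) \<notin> arcs (edges G) ^^ k)"
proof -
  obtain r where r: "2 / (1 - 4 * \<epsilon>) \<le> real r" using real_arch_simple by blast
  \<comment> \<open>\<open>g 3\<close> makes triangles forbidden on \<open>n\<close> vertices;
    \<open>r\<close> makes the gap \<open>1/4 - \<epsilon>\<close> outweigh the linear term of the
    edge count.\<close>
  define n where "n = N + g 3 + r + 1"
  define G :: graph where "G = ({..<n}, {e. e \<subseteq> {..<n} \<and> card e = 2})"
  have G: "simple_graph G" by (auto simp: simple_graph_def G_def)
  have n: "N \<le> n" "g 3 \<le> n" "1 \<le> n" "real r \<le> real n" by (auto simp: n_def)
  have "2 \<le> (1 - 4 * \<epsilon>) * n"
  proof -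
    have "2 / (1 - 4 * \<epsilon>) \<le> n" using r n(4) by linarith
    then show ?thesis using assms by (simp add: pos_divide_le_eq mult.commute)
  qed
  then have big: "2 * real n \<le> (1 - 4 * \<epsilon>) * n ^ 2"
    using mult_right_mono[of 2 "(1 - 4 * \<epsilon>) * n" "real n"] by (simp add: power2_eq_square mult.assoc)
  have cardE: "2 * card (edges G) = n * (n - 1)"
  proof -
    have "card (edges G) = n choose 2" unfolding G_def by (simp add: n_subsets)
    then show ?thesis using times_binomial_minus1_eq[of 2 n] by simp
  qed
  have far: "real (card D) \<ge> \<epsilon> * real (card (verts G)) ^ 2"
    if D: "D \<subseteq> edges G" "remove_edges G D \<in> slow_odd_girth g" for D
  proof -
    have "odd (3 :: nat)" by simp
    then have "(v, v) \<notin> arcs (edges (remove_edges G D)) ^^ 3" for v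
      using D(2) n(2) by (auto simp: slow_odd_girth_def remove_edges_def G_def)
    moreover have "simple_graph (remove_edges G D)" using D(2) by (simp add: slow_odd_girth_def)
    ultimately have "4 * card (edges G - D) \<le> n ^ 2"
      using triangle_free_edge_bound[of "remove_edges G D"] by (simp add: remove_edges_def G_def)
    moreover have "card (edges G - D) = card (edges G) - card D" "card D \<le> card (edges G)"
      using D(1) finite_edges[OF G] by (simp_all add: card_Diff_subset finite_subset[OF D(1)] card_mono)
    ultimately have "4 * card (edges G) \<le> n ^ 2 + 4 * card D" by linarith
    then have "2 * (n * (n - 1)) \<le> n ^ 2 + 4 * card D" using cardE by linarith
    then have "real (2 * (n * (n - 1))) \<le> real (n ^ 2 + 4 * card D)" by (simp only: of_nat_le_iff)
    then have "2 * (real n * (real n - 1)) \<le> real n ^ 2 + 4 * real (card D)"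
      using n(3) by (simp add: of_nat_diff)
    then show ?thesis using big by (simp add: G_def power2_eq_square algebra_simps)
  qed
  have "eps_far \<epsilon> (slow_odd_girth g) G"
    unfolding eps_far_def by (intro allI impI far)
  moreover have "(v, v) \<notin> arcs (edges G) ^^ k" if "odd k" "k < 3" for k v
  proof -
    have "k = 1" using that by presburger
    then show ?thesis by (simp add: G_def)
  qed
  ultimately show ?thesis using G n(1) by (intro exI[of _ G]) (auto simp: G_def)
qed

text \<open>\<open>pos\<close> maps each edge to a step along a cycle of length \<open>l\<close>;
  \<open>s\<close> counts forward minus backward steps, hence has the parity of
  \<open>k\<close>.\<close>

lemma walk_into_cycle:
  assumes "(x, y) \<in> arcs E ^^ k"
    and "\<And>u v. {u, v} \<in> E \<Longrightarrow> (pos u + 1) mod int l = pos v mod int l \<or> (pos v + 1) mod int l = pos u mod int l"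
  shows "\<exists>s. \<bar>s\<bar> \<le> int k \<and> even (s - int k) \<and> (pos x + s) mod int l = pos y mod int l"
  using assms(1)
proof (induction k arbitrary: y)
  case 0
  then show ?case by (intro exI[of _ 0]) auto
next
  case (Suc k)
  then obtain z where z: "(x, z) \<in> arcs E ^^ k" "{z, y} \<in> E" by auto
  then obtain s where s: "\<bar>s\<bar> \<le> int k" "even (s - int k)" "(pos x + s) mod int l = pos z mod int l"
    using Suc.IH by blast
  from assms(2)[OF z(2)] show ?case
  proof
    assume "(pos z + 1) mod int l = pos y mod int l"
    then have "(pos x + (s + 1)) mod int l = pos y mod int l"
      using s(3) by (metis add.assoc mod_add_left_eq)
    then show ?thesis using s by (intro exI[of _ "s + 1"]) auto
  next
    assume "(pos y + 1) mod int l = pos z mod int l"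
    then have "(pos x + (s - 1)) mod int l = pos y mod int l"
      using s(3) mod_diff_left_eq[of "pos x + s" "int l" 1] mod_diff_left_eq[of "pos z" "int l" 1] 
        mod_diff_left_eq[of "pos y + 1" "int l" 1] by (simp add: algebra_simps)
    then show ?thesis using s by (intro exI[of _ "s - 1"]) auto
  qed
qed

text \<open>For a closed walk \<open>l\<close> divides the net displacement \<open>s\<close>, which
  is odd and so nonzero, yet \<open>s\<close> is at most \<open>k < l\<close> in absolute
  value.\<close>

lemma no_short_odd_closed_walk:
  assumes "\<And>u v. {u, v} \<in> E \<Longrightarrow> (pos u + 1) mod int l = pos v mod int l \<or> (pos v + 1) mod int l = pos u mod int l"
    and "odd k" "k < l"
  shows "(v, v) \<notin> arcs E ^^ k"
proof
  assume "(v, v) \<in> arcs E ^^ k"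
  then obtain s where s: "\<bar>s\<bar> \<le> int k" "even (s - int k)" "(pos v + s) mod int l = pos v mod int l"
    using walk_into_cycle[of v v k E pos l, OF _ assms(1)] by blast
  then have "int l dvd s" by (metis add_diff_cancel_left' mod_eq_dvd_iff)
  moreover have "s \<noteq> 0" using s(2) assms(2) by auto
  ultimately have "int l \<le> \<bar>s\<bar>" by (metis abs_of_nat dvd_imp_le_int)
  then show False using s(1) assms(3) by linarith
qed

lemma mod_add_left_inj:
  assumes "(a + b) mod m = (a + b') mod m" "b < m" "b' < (m :: nat)"
  shows "b = b'"
proof -
  have "int ((a + b) mod m) = int ((a + b') mod m)" using assms(1) by simp
  then have "(int a + int b) mod int m = (int a + int b') mod int m" by (simp add: zmod_int)
  then have "int m dvd int b - int b'" by (metis add_diff_cancel_left mod_eq_dvd_iff)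
  moreover have "\<bar>int b - int b'\<bar> < int m" using assms by linarith
  ultimately have "int b - int b' = 0" by (metis abs_of_nat dvd_imp_le_int linorder_not_less)
  then show ?thesis by simp
qed

text \<open>The equations would give \<open>2 = 0\<close> modulo \<open>l\<close>. This excludes
  that two cycles of the blow-up share an edge in opposite directions.\<close>

lemma no_cyclic_two_step:
  assumes "a < l" "b < l" "3 \<le> l" "a = Suc b mod l" "b = Suc a mod l"
  shows False
proof (cases "Suc b = l")
  case True
  then have "a = 0" using assms(4) by simp
  then have "b = 1" using assms(3,5) by simp
  then show ?thesis using True assms(3) by simp
next
  case False
  then have a: "a = Suc b" using assms(2,4) by simp
  have "Suc a \<noteq> l"
  proof
    assume l: "Suc a = l"
    then have "b = 0" using assms(5) by simp
    then show False using a l assms(3) by simp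
  qed
  then have "Suc a mod l = Suc a" using assms(1) by simp
  then show ?thesis using a assms(5) by linarith
qed

text \<open>In the \<open>m\<close>-fold blow-up of \<open>C\<^sub>\<ell>\<close> the cycles that run through the copies
  \<open>a, b, a, b, \<dots>, a, b, (a + b) mod m\<close> of the successive vertices are edge-disjoint: any two
  cyclically consecutive entries determine \<open>a\<close> and \<open>b\<close>.\<close>

lemma cycle_blowup_far:
  assumes l: "odd l" "3 \<le> l" and eps: "\<epsilon> * real l ^ 2 \<le> 1"
  shows "\<exists>G. simple_graph G \<and> N \<le> card (verts G) \<and> eps_far \<epsilon> (slow_odd_girth g) G
        \<and> (\<forall>k v. odd k \<longrightarrow> k < l \<longrightarrow> (v, v) \<notin> arcs (edges G) ^^ k)"
proof -
  \<comment> \<open>With \<open>g l\<close> at most the number of vertices, closed walks of length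
    \<open>l\<close> are forbidden.\<close>
  define m where "m = N + g l + 1"
  define E where "E = {{x, y} | x y. x < l * m \<and> y < l * m \<and> (x + 1) mod l = y mod l}"
  define G :: graph where "G = ({..<l * m}, E)"
  have G_sel [simp]: "verts G = {..<l * m}" "edges G = E" by (simp_all add: G_def)
  have "1 * m \<le> l * m" using l by (intro mult_le_mono1) simp
  then have m: "N \<le> l * m" "g l \<le> l * m" "0 < m" by (simp_all add: m_def)
  have ne: "x \<noteq> y" if "(x + 1) mod l = y mod l" for x y
    using that l by (auto simp: mod_Suc split: if_splits)
  have G: "simple_graph G"
    unfolding simple_graph_def G_sel
  proof (intro conjI ballI)
    fix e assume "e \<in> E"
    then obtain x y where e: "e = {x, y}" "x < l * m" "y < l * m" "(x + 1) mod l = y mod l"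
      unfolding E_def by blast
    then show "e \<subseteq> {..<l * m}" "card e = 2" using ne[OF e(4)] by simp_all
  qed simp
  have pos: "(int u + 1) mod int l = int v mod int l \<or> (int v + 1) mod int l = int u mod int l"
    if "{u, v} \<in> E" for u v
  proof -
    have "(u + 1) mod l = v mod l \<or> (v + 1) mod l = u mod l"
      using that by (auto simp: E_def doubleton_eq_iff)
    then have "int ((u + 1) mod l) = int (v mod l) \<or> int ((v + 1) mod l) = int (u mod l)" by auto
    then show ?thesis by (simp add: zmod_int add.commute)
  qed
  have far: "real (card D) \<ge> \<epsilon> * real (card (verts G)) ^ 2"
    if D: "D \<subseteq> edges G" "remove_edges G D \<in> slow_odd_girth g" for D
  proof -
    define idx where "idx = (\<lambda>(a, b) i. if i = l - 1 then (a + b) mod m else if even i then a else b)"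
    \<comment> \<open>The residue modulo \<open>l\<close> is the position on the cycle, the quotient
      by \<open>l\<close> the number of the copy.\<close>
    define q where "q ab i = i mod l + l * idx ab (i mod l)" for ab i
    define M where "M = {..<m} \<times> {..<m}"
    have idx: "idx ab i < m" if "ab \<in> M" for ab i
      using that m(3) by (auto simp: idx_def M_def)
    have q_mod: "q ab i mod l = i mod l" and q_div: "q ab i div l = idx ab (i mod l)" for ab i
      using l by (simp_all add: q_def)
    have q_less: "q ab i < l * m" if "ab \<in> M" for ab i
    proof -
      have "i mod l < l" using l by simp
      then have "q ab i < l * (idx ab (i mod l) + 1)" by (simp add: q_def)
      also have "\<dots> \<le> l * m" using idx[OF that, of "i mod l"] by (intro mult_le_mono2) simp
      finally show ?thesis .
    qed
    have q_edge: "{q ab i, q ab (Suc i)} \<in> E" if "ab \<in> M" for ab i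
    proof -
      have "(q ab i + 1) mod l = q ab (Suc i) mod l" using q_mod[of ab i] q_mod[of ab "Suc i"]
        by (metis Suc_eq_plus1 mod_Suc_eq)
      then show ?thesis using q_less[OF that] unfolding E_def by blast
    qed
    \<comment> \<open>A cycle that keeps all its edges would be a forbidden closed walk of length
      \<open>l\<close>.\<close>
    have "\<exists>i < l. {q ab i, q ab (Suc i)} \<in> D" if "ab \<in> M" for ab
    proof (rule ccontr)
      assume "\<not> ?thesis"
      then have "\<forall>i<l. (q ab i, q ab (Suc i)) \<in> arcs (edges (remove_edges G D))"
        using q_edge[OF that] by (auto simp: remove_edges_def)
      moreover have "q ab l = q ab 0" by (simp add: q_def)
      ultimately have "(q ab 0, q ab 0) \<in> arcs (edges (remove_edges G D)) ^^ l"
        unfolding relpow_fun_conv by metis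
      then show False using D(2) l(1) m(2) by (simp add: slow_odd_girth_def remove_edges_def)
    qed
    then obtain i where i: "\<And>ab. ab \<in> M \<Longrightarrow> i ab < l \<and> {q ab (i ab), q ab (Suc (i ab))} \<in> D"
      by metis
    have "inj_on (\<lambda>ab. {q ab (i ab), q ab (Suc (i ab))}) M"
    proof (rule inj_onI)
      fix x y assume xy: "x \<in> M" "y \<in> M"
        and eq: "{q x (i x), q x (Suc (i x))} = {q y (i y), q y (Suc (i y))}"
      have il: "i x < l" "i y < l" using i xy by auto
      from eq consider "q x (i x) = q y (i y)" "q x (Suc (i x)) = q y (Suc (i y))"
        | "q x (i x) = q y (Suc (i y))" "q x (Suc (i x)) = q y (i y)"
        by (auto simp: doubleton_eq_iff)
      then show "x = y"
      proof cases
        case 1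
        define j where "j = i x"
        have "i x = i y" using q_mod[of x "i x"] q_mod[of y "i y"] 1(1) il by simp
        then have "idx x (j mod l) = idx y (j mod l)" "idx x (Suc j mod l) = idx y (Suc j mod l)"
          using q_div[of x j] q_div[of y j] q_div[of x "Suc j"] q_div[of y "Suc j"] 1 by (auto simp: j_def)
        then have eqs: "idx x j = idx y j" "idx x (if Suc j = l then 0 else Suc j) = idx y (if Suc j = l then 0 else Suc j)"
          using il by (auto simp: j_def)
        obtain a b a' b' where ab: "x = (a, b)" "y = (a', b')" by (cases x, cases y)
        have less: "a < m" "b < m" "a' < m" "b' < m" using xy ab by (auto simp: M_def)
        \<comment> \<open>The entries at \<open>j\<close> and its cyclic successor are
          \<open>a + b, a\<close>, or \<open>b, a + b\<close> (as \<open>l - 2\<close> is odd), or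
          \<open>a\<close> and \<open>b\<close> in some order.\<close>
        consider "Suc j = l" | "Suc (Suc j) = l" | "Suc (Suc j) < l" using il j_def by linarith
        then have "a = a' \<and> b = b'"
        proof cases
          case 1
          then have "(a + b) mod m = (a' + b') mod m" "a = a'"
            using eqs l by (auto simp: idx_def ab split: if_splits)
          then show ?thesis using mod_add_left_inj less by blast
        next
          case 2
          then have "odd j" using l by auto
          then have "(a + b) mod m = (a' + b') mod m" "b = b'"
            using eqs l 2 by (auto simp: idx_def ab split: if_splits)
          then show ?thesis using mod_add_left_inj[of b a m a'] less by (simp add: add.commute)
        next
          case 3
          then show ?thesis using eqs by (auto simp: idx_def ab split: if_splits)
        qed
        then show ?thesis by (simp add: ab)
      next
        case 2
        have "i x = Suc (i y) mod l"
          using q_mod[of x "i x"] q_mod[of y "Suc (i y)"] 2(1) il by simp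
        moreover have "i y = Suc (i x) mod l"
          using q_mod[of x "Suc (i x)"] q_mod[of y "i y"] 2(2) il by simp
        ultimately show ?thesis using no_cyclic_two_step[OF il l(2)] by blast
      qed
    qed
    moreover have "(\<lambda>ab. {q ab (i ab), q ab (Suc (i ab))}) ` M \<subseteq> D" using i by blast
    moreover have "finite D" using D(1) finite_edges[OF G] by (rule finite_subset)
    ultimately have "card M \<le> card D" by (rule card_inj_on_le)
    then have "real (m * m) \<le> real (card D)" unfolding M_def card_cartesian_product by (simp only: card_lessThan of_nat_le_iff)
    moreover have "\<epsilon> * real (l * m) ^ 2 \<le> real (m * m)"
      using mult_right_mono[OF eps, of "real m ^ 2"] by (simp add: power2_eq_square algebra_simps)
    ultimately show ?thesis by simp
  qed
  have "eps_far \<epsilon> (slow_odd_girth g) G"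
    unfolding eps_far_def by (intro allI impI far)
  moreover have "(v, v) \<notin> arcs (edges G) ^^ k" if "odd k" "k < l" for k v
    using no_short_odd_closed_walk[of E int l, OF pos that] by simp
  moreover have "N \<le> card (verts G)" using m(1) by simp
  ultimately show ?thesis using G by blast
qed

section \<open>Robust breadth-first search\<close>

definition nbrs :: "'a set set \<Rightarrow> 'a set \<Rightarrow> 'a \<Rightarrow> 'a set" where
  "nbrs E A u = {x \<in> A. {u, x} \<in> E}"

text \<open>A vertex enters a layer after the first one only if it has at least \<open>d\<close> neighbours in the
  previous layer; for linear \<open>d\<close> a random sample of constant size then contains such a neighbour. The
  two components are the ball and the layer of the given radius around \<open>v\<close>.\<close>

primrec robust_bfs :: "'a set set \<Rightarrow> 'a set \<Rightarrow> real \<Rightarrow> 'a \<Rightarrow> nat \<Rightarrow> 'a set \<times> 'a set" where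
  "robust_bfs E W d v 0 = ({v}, {v})"
| "robust_bfs E W d v (Suc i) =
    (let B = fst (robust_bfs E W d v i); L = snd (robust_bfs E W d v i);
         L' = {u \<in> W - B. (if i = 0 then 1 else d) \<le> real (card (nbrs E L u))}
     in (B \<union> L', L'))"

definition rball :: "'a set set \<Rightarrow> 'a set \<Rightarrow> real \<Rightarrow> 'a \<Rightarrow> nat \<Rightarrow> 'a set" where
  "rball E W d v i = fst (robust_bfs E W d v i)"

definition rlayer :: "'a set set \<Rightarrow> 'a set \<Rightarrow> real \<Rightarrow> 'a \<Rightarrow> nat \<Rightarrow> 'a set" where
  "rlayer E W d v i = snd (robust_bfs E W d v i)"

text \<open>A sampled vertex of this set together with a sampled neighbour in the same layer closes
  an odd walk through \<open>v\<close>.\<close>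

definition heavy :: "'a set set \<Rightarrow> 'a set \<Rightarrow> real \<Rightarrow> 'a \<Rightarrow> nat \<Rightarrow> 'a set" where
  "heavy E W d v i = {u \<in> rlayer E W d v i. d \<le> real (card (nbrs E (rlayer E W d v i) u))}"

lemma rlayer_0: "rlayer E W d v 0 = {v}"
  by (simp add: rlayer_def)

lemma rlayer_Suc: "rlayer E W d v (Suc i) =
    {u \<in> W - rball E W d v i. (if i = 0 then 1 else d) \<le> real (card (nbrs E (rlayer E W d v i) u))}"
  by (simp add: rlayer_def rball_def Let_def)

lemma rball_0: "rball E W d v 0 = {v}"
  by (simp add: rball_def)

lemma rball_Suc: "rball E W d v (Suc i) = rball E W d v i \<union> rlayer E W d v (Suc i)"
  by (simp add: rlayer_def rball_def Let_def)

lemma rball_UN: "rball E W d v i = (\<Union>j\<le>i. rlayer E W d v j)"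
  by (induction i) (auto simp: rball_0 rlayer_0 rball_Suc atMost_Suc)

lemma rlayer_disjoint:
  assumes "u \<in> rlayer E W d v i" "u \<in> rlayer E W d v j"
  shows "i = j"
proof -
  have "u \<notin> rlayer E W d v j" if "i < j" "u \<in> rlayer E W d v i" for i j
  proof -
    obtain k where k: "j = Suc k" "i \<le> k" using \<open>i < j\<close> by (cases j) auto
    have "u \<in> rball E W d v k" using that(2) k(2) by (auto simp: rball_UN)
    then show ?thesis by (simp add: k(1) rlayer_Suc)
  qed
  then show ?thesis using assms by (metis linorder_neqE_nat)
qed

lemma card_UN_image_le:
  assumes "finite W" "\<And>u. u \<in> W \<Longrightarrow> finite (B u)"
  shows "real (card (\<Union>u\<in>W. f u ` B u)) \<le> (\<Sum>u\<in>W. real (card (B u)))"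
proof -
  have "card (\<Union>u\<in>W. f u ` B u) \<le> (\<Sum>u\<in>W. card (f u ` B u))" using assms(1) by (rule card_UN_le)
  also have "\<dots> \<le> (\<Sum>u\<in>W. card (B u))" using assms(2) by (intro sum_mono card_image_le)
  finally have "real (card (\<Union>u\<in>W. f u ` B u)) \<le> real (\<Sum>u\<in>W. card (B u))" by (simp only: of_nat_le_iff)
  then show ?thesis by simp
qed

section \<open>Parity colouring of a ball\<close>

context
  fixes E :: "'a set set" and W :: "'a set" and d :: real and v :: 'a
  assumes fin: "finite W" and v: "v \<in> W" and d: "0 \<le> d"
begin

private abbreviation "L \<equiv> rlayer E W d v"
private abbreviation "B \<equiv> rball E W d v"

lemma rlayer_subset: "L i \<subseteq> W"
  using v by (cases i) (auto simp: rlayer_0 rlayer_Suc)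

lemma rball_subset: "B i \<subseteq> W"
  using rlayer_subset by (auto simp: rball_UN)

lemma finite_rlayer: "finite (L i)"
  using rlayer_subset fin by (rule finite_subset)

lemma finite_rball: "finite (B i)"
  using rball_subset fin by (rule finite_subset)

lemma card_rball_Suc: "card (B (Suc i)) = card (B i) + card (L (Suc i))"
  unfolding rball_Suc by (intro card_Un_disjoint finite_rlayer finite_rball) (auto simp: rlayer_Suc)

lemma card_rball: "card (B i) = (\<Sum>j\<le>i. card (L j))"
  by (induction i) (simp_all add: rball_0 rlayer_0 card_rball_Suc)

lemma nbrs_subset_rball_1: "nbrs E W v \<subseteq> B 1"
proof
  fix u assume u: "u \<in> nbrs E W v"
  then have "{u, v} \<in> E" by (simp add: nbrs_def insert_commute)
  then have "nbrs E {v} u = {v}" by (auto simp: nbrs_def)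
  then have "card (nbrs E {v} u) = 1" by simp
  then show "u \<in> B 1" using u by (auto simp: nbrs_def rball_Suc rball_0 rlayer_Suc rlayer_0)
qed

text \<open>\<open>u\<close> failed the test for layer \<open>Suc i\<close>. For
  \<open>i = 0\<close> the threshold is 1, so then \<open>u\<close> has no neighbour in the layer at
  all.\<close>

lemma few_back_nbrs:
  assumes "u \<in> W" "u \<notin> B (Suc i)"
  shows "real (card (nbrs E (L i) u)) \<le> d"
  using assms d by (auto simp: rball_Suc rlayer_Suc split: if_splits)

text \<open>The at most \<open>d\<close> heavy vertices contribute at most \<open>card (L i)\<close>
  each, all others less than \<open>d\<close> each.\<close>

lemma sum_nbrs_in_layer:
  assumes "real (card (heavy E W d v i)) \<le> d"
  shows "(\<Sum>u\<in>L i. real (card (nbrs E (L i) u))) \<le> 2 * d * real (card (L i))"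
proof -
  let ?H = "heavy E W d v i"
  have H: "?H \<subseteq> L i" by (auto simp: heavy_def)
  have "(\<Sum>u\<in>L i. real (card (nbrs E (L i) u))) \<le> (\<Sum>u\<in>L i. (if u \<in> ?H then real (card (L i)) else 0) + d)"
  proof (rule sum_mono)
    fix u assume u: "u \<in> L i"
    have "card (nbrs E (L i) u) \<le> card (L i)"
      using finite_rlayer by (intro card_mono) (auto simp: nbrs_def)
    then show "real (card (nbrs E (L i) u)) \<le> (if u \<in> ?H then real (card (L i)) else 0) + d"
      using d u by (auto simp: heavy_def)
  qed
  also have "\<dots> = real (card ?H) * real (card (L i)) + real (card (L i)) * d"
    using H finite_rlayer by (simp add: sum.distrib sum.If_cases Int_absorb1)
  also have "\<dots> \<le> d * real (card (L i)) + real (card (L i)) * d"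
    using assms by (intro add_mono mult_right_mono) auto
  finally show ?thesis by simp
qed

text \<open>Meaningful only for vertices of some layer, which is why \<open>rball_lev\<close> also
  asks for membership in that layer.\<close>

definition lev :: "'a \<Rightarrow> nat" where
  "lev u = (THE j. u \<in> L j)"

lemma lev_eq: "u \<in> L j \<Longrightarrow> lev u = j"
  unfolding lev_def using rlayer_disjoint by (metis the_equality)

lemma rball_lev: "u \<in> B r \<longleftrightarrow> u \<in> L (lev u) \<and> lev u \<le> r"
  using lev_eq by (auto simp: rball_UN)

text \<open>Edges inside a layer or skipping a layer spoil the colouring of the ball by the parity of the
  layers, and edges leaving the ball are lost. Each such edge is charged to the endpoint from which
  it goes backwards.\<close>

definition backward :: "nat \<Rightarrow> 'a \<Rightarrow> 'a set" where
  "backward r u = {x \<in> nbrs E (B r) u. u \<in> B r \<longrightarrow> lev x = lev u \<or> Suc (lev x) < lev u}"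

text \<open>The one layer whose share of \<open>backward r u\<close> is not bounded by the entry
  threshold: the layer of \<open>u\<close> itself, or the outermost layer if \<open>u\<close> is
  outside the ball.\<close>

definition top_layer :: "nat \<Rightarrow> 'a \<Rightarrow> nat" where
  "top_layer r u = (if u \<in> B r then lev u else r)"

text \<open>A backward neighbour below the top layer lies in some layer \<open>i\<close> with
  \<open>u\<close> outside \<open>B (Suc i)\<close>, so \<open>few_back_nbrs\<close> allows at most
  \<open>d\<close> of them per layer, for at most \<open>r\<close> layers.\<close>

lemma card_backward_le:
  assumes u: "u \<in> W"
  shows "real (card (backward r u)) \<le> real r * d + real (card (nbrs E (L (top_layer r u)) u))"
proof -
  define j where "j = top_layer r u"
  let ?I = "{i. i < j \<and> u \<notin> B (Suc i)}"
  have "j \<le> r" using rball_lev[of u r] by (auto simp: j_def top_layer_def)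
  have sub: "backward r u \<subseteq> (\<Union>i\<in>?I. nbrs E (L i) u) \<union> nbrs E (L j) u"
  proof
    fix x assume x: "x \<in> backward r u"
    then have x': "x \<in> L (lev x)" "lev x \<le> r" "{u, x} \<in> E" using rball_lev[of x r] by (auto simp: backward_def nbrs_def)
    show "x \<in> (\<Union>i\<in>?I. nbrs E (L i) u) \<union> nbrs E (L j) u"
    proof (cases "lev x = j")
      case True
      then show ?thesis using x' by (auto simp: nbrs_def)
    next
      case False
      have "lev x < j \<and> u \<notin> B (Suc (lev x))"
      proof (cases "u \<in> B r")
        case True
        then have "Suc (lev x) < lev u" using x False by (auto simp: backward_def j_def top_layer_def)
        then show ?thesis using True rball_lev[of u "Suc (lev x)"] by (auto simp: j_def top_layer_def)
      next
        case out: False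
        then have "lev x < r" using x' False by (auto simp: j_def top_layer_def)
        then show ?thesis using out by (auto simp: j_def top_layer_def rball_UN)
      qed
      then show ?thesis using x' by (auto simp: nbrs_def)
    qed
  qed
  have fin_n: "finite (nbrs E (L i) u)" for i using finite_rlayer by (simp add: nbrs_def)
  have "card (backward r u) \<le> card ((\<Union>i\<in>?I. nbrs E (L i) u) \<union> nbrs E (L j) u)"
    using sub fin_n by (intro card_mono) auto
  also have "\<dots> \<le> card (\<Union>i\<in>?I. nbrs E (L i) u) + card (nbrs E (L j) u)" by (rule card_Un_le)
  also have "card (\<Union>i\<in>?I. nbrs E (L i) u) \<le> (\<Sum>i\<in>?I. card (nbrs E (L i) u))" by (intro card_UN_le) simp
  finally have "real (card (backward r u)) \<le> real ((\<Sum>i\<in>?I. card (nbrs E (L i) u)) + card (nbrs E (L j) u))"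
    by (simp only: of_nat_le_iff add_le_cancel_right) 
  also have "\<dots> = (\<Sum>i\<in>?I. real (card (nbrs E (L i) u))) + real (card (nbrs E (L j) u))" by simp
  also have "(\<Sum>i\<in>?I. real (card (nbrs E (L i) u))) \<le> real (card ?I) * d"
    using few_back_nbrs[OF u] by (intro sum_bounded_above) auto
  also have "real (card ?I) * d \<le> real r * d"
  proof -
    have "card ?I \<le> card {..<j}" by (intro card_mono) auto
    then show ?thesis using \<open>j \<le> r\<close> d by (intro mult_right_mono) auto
  qed
  finally show ?thesis by (simp add: j_def)
qed

text \<open>Each vertex pays \<open>r * d\<close> for lower layers, and outside the ball another
  \<open>d\<close> for layer \<open>r\<close>. The product covers the edges from layer
  \<open>r\<close> to the next one, the last term the edges within layers.\<close>

lemma sum_card_backward_le: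
  assumes light: "\<And>i. i \<le> r \<Longrightarrow> real (card (heavy E W d v i)) \<le> d"
  shows "(\<Sum>u\<in>W. real (card (backward r u))) \<le>
    real (card W) * (real r + 1) * d + real (card (L r)) * real (card (L (Suc r))) + 2 * d * real (card (B r))"
proof -
  let ?c = "\<lambda>u. real (card (nbrs E (L (top_layer r u)) u))"
  have "(\<Sum>u\<in>W. real (card (backward r u))) \<le> (\<Sum>u\<in>W. real r * d + ?c u)"
    by (intro sum_mono card_backward_le)
  also have "\<dots> = real (card W) * (real r * d) + (\<Sum>u\<in>W. ?c u)" by (simp add: sum.distrib)
  also have "(\<Sum>u\<in>W. ?c u) = (\<Sum>u\<in>W - B r. ?c u) + (\<Sum>u\<in>B r. ?c u)"
    using fin rball_subset by (intro sum.subset_diff)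
  also have "(\<Sum>u\<in>B r. ?c u) = (\<Sum>j\<le>r. \<Sum>u\<in>L j. ?c u)"
    unfolding rball_UN
    by (intro sum.UNION_disjoint ballI impI equals0I finite_rlayer) (auto dest: rlayer_disjoint)
  also have "\<dots> = (\<Sum>j\<le>r. \<Sum>u\<in>L j. real (card (nbrs E (L j) u)))"
  proof (intro sum.cong refl)
    fix j u assume "j \<in> {..r}" "u \<in> L j"
    then have "top_layer r u = j" using rball_lev[of u r] lev_eq by (simp add: top_layer_def)
    then show "?c u = real (card (nbrs E (L j) u))" by simp
  qed
  also have "\<dots> \<le> (\<Sum>j\<le>r. 2 * d * real (card (L j)))"
    using sum_nbrs_in_layer light by (intro sum_mono) simp
  also have "\<dots> = 2 * d * real (card (B r))" by (simp add: card_rball sum_distrib_left)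
  also have "(\<Sum>u\<in>W - B r. ?c u) \<le> (\<Sum>u\<in>W - B r. (if u \<in> L (Suc r) then real (card (L r)) else 0) + d)"
  proof (rule sum_mono)
    fix u assume u: "u \<in> W - B r"
    have "card (nbrs E (L r) u) \<le> card (L r)"
      using finite_rlayer by (intro card_mono) (auto simp: nbrs_def)
    moreover have "real (card (nbrs E (L r) u)) \<le> d" if "u \<notin> L (Suc r)"
      using u that few_back_nbrs[of u r] by (auto simp: rball_Suc)
    ultimately show "?c u \<le> (if u \<in> L (Suc r) then real (card (L r)) else 0) + d"
      using u d by (auto simp: top_layer_def)
  qed
  also have "\<dots> = real (card (L r)) * real (card (L (Suc r))) + real (card (W - B r)) * d"
  proof -
    have "(W - B r) \<inter> {u. u \<in> L (Suc r)} = L (Suc r)" using rlayer_subset by (auto simp: rlayer_Suc)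
    then show ?thesis using fin by (simp add: sum.distrib sum.If_cases)
  qed
  also have "real (card (W - B r)) * d \<le> real (card W) * d"
    using fin d by (intro mult_right_mono) (auto intro: card_mono)
  finally show ?thesis by (simp add: algebra_simps)
qed

text \<open>No surviving edge leaves the ball, so the remaining vertices can be coloured
  independently of it.\<close>

lemma colour_ball:
  assumes light: "\<And>i. i \<le> r \<Longrightarrow> real (card (heavy E W d v i)) \<le> d"
  obtains D col where "finite D"
    "real (card D) \<le> real (card W) * (real r + 1) * d + real (card (L r)) * real (card (L (Suc r)))
      + 2 * d * real (card (B r))"
    "\<And>u x. u \<in> W \<Longrightarrow> x \<in> B r \<Longrightarrow> {u, x} \<in> E \<Longrightarrow> {u, x} \<notin> D \<Longrightarrow> u \<in> B r \<and> col u \<noteq> (col x :: bool)"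
proof -
  define D where "D = (\<Union>u\<in>W. (\<lambda>x. {u, x}) ` backward r u)"
  have fin_b: "finite (backward r u)" for u using finite_rball by (simp add: backward_def nbrs_def)
  have D: "{u, x} \<in> D" if "u \<in> W" "x \<in> backward r u" for u x using that by (auto simp: D_def)
  have "u \<in> B r \<and> even (lev u) \<noteq> even (lev x)"
    if ux: "u \<in> W" "x \<in> B r" "{u, x} \<in> E" "{u, x} \<notin> D" for u x
  proof -
    have nb: "x \<notin> backward r u" using D ux by blast
    then have u: "u \<in> B r" using ux by (auto simp: backward_def nbrs_def)
    have xu: "{x, u} = {u, x}" by blast
    then have "u \<notin> backward r x" using D[of x u] ux(2,4) rball_subset by auto
    \<comment> \<open>Neither end counts the other as backward, so the levels differ by exactly
      1.\<close>
    then have "lev x \<noteq> lev u" "\<not> Suc (lev x) < lev u" "\<not> Suc (lev u) < lev x"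
      using nb ux u xu by (auto simp: backward_def nbrs_def)
    then have "lev x = Suc (lev u) \<or> lev u = Suc (lev x)" by linarith
    then show ?thesis using u by auto
  qed
  moreover have "finite D" using fin fin_b by (simp add: D_def)
  moreover have "real (card D) \<le> (\<Sum>u\<in>W. real (card (backward r u)))"
    unfolding D_def by (rule card_UN_image_le[OF fin fin_b])
  ultimately show ?thesis using that[of D "\<lambda>u. even (lev u)"] sum_card_backward_le[OF light] by force
qed

end

text \<open>By the inequality of arithmetic and geometric means, two consecutive layers with product
  above \<open>k * b r\<close> add more than \<open>2 * sqrt (k * b r)\<close> vertices, so the ball
  grows quadratically in the radius.\<close>

lemma ball_growth:
  fixes b l :: "nat \<Rightarrow> real" and k :: real
  assumes k: "0 < k" and b: "\<And>i. b (Suc i) = b i + l (Suc i)" and l: "\<And>i. 0 \<le> l i"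
    and one: "k \<le> b 1"
    and thick: "\<And>r. 1 \<le> r \<Longrightarrow> r \<le> 2 * J \<Longrightarrow> k * b r < l r * l (Suc r)"
    and j: "j \<le> J"
  shows "k * ((real j + 1) / 2) ^ 2 \<le> b (2 * j + 1)"
  using j
proof (induction j)
  case 0
  then show ?case using one k by (simp add: power2_eq_square)
next
  case (Suc j)
  define t where "t = (real j + 1) / 2"
  have t: "1 / 2 \<le> t" by (simp add: t_def)
  have IH: "k * t ^ 2 \<le> b (2 * j + 1)" using Suc by (simp add: t_def)
  define x y where "x = l (2 * j + 2)" and "y = l (2 * j + 3)"
  have xy: "0 \<le> x" "0 \<le> y" using l by (auto simp: x_def y_def)
  have "b (2 * j + 2) = b (2 * j + 1) + x" "b (2 * j + 3) = b (2 * j + 2) + y"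
    using b[of "2 * j + 1"] b[of "2 * j + 2"] by (simp_all add: x_def y_def numeral_3_eq_3)
  then have b2: "b (2 * j + 1) \<le> b (2 * j + 2)" and b3: "b (2 * j + 3) = b (2 * j + 1) + (x + y)"
    using xy by auto
  have "k * (k * t ^ 2) \<le> k * b (2 * j + 2)" using IH b2 k by (intro mult_left_mono) auto
  also have "\<dots> < x * y" using thick[of "2 * j + 2"] Suc.prems by (simp add: x_def y_def numeral_3_eq_3)
  finally have "4 * (k * t) ^ 2 < 4 * (x * y)" by (simp add: power2_eq_square mult_ac)
  also have "\<dots> \<le> (x + y) ^ 2" using sum_squares_ge_zero[of "x - y" 0] by (simp add: power2_eq_square algebra_simps)
  finally have "(2 * (k * t)) ^ 2 < (x + y) ^ 2" by (simp add: power_mult_distrib)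
  then have "2 * (k * t) < x + y" using xy by (meson add_nonneg_nonneg power2_less_imp_less)
  \<comment> \<open>The cross term of the square is \<open>k * t\<close>; the second
    \<open>k * t\<close> pays for \<open>k / 4\<close> because \<open>t \<ge> 1/2\<close>.\<close>
  moreover have "k * (t + 1 / 2) ^ 2 \<le> k * t ^ 2 + 2 * (k * t)"
  proof -
    have "k * (1 / 4) \<le> k * t" using k t by (intro mult_left_mono) auto
    then show ?thesis by (simp add: power2_eq_square algebra_simps)
  qed
  moreover have "(real (Suc j) + 1) / 2 = t + 1 / 2" by (simp add: t_def field_simps)
  moreover have "2 * Suc j + 1 = 2 * j + 3" by simp
  ultimately show ?case using IH b3 by (simp only:)
qed

text \<open>Komlos' argument: thick boundaries force the ball of radius \<open>2 j + 1\<close> to have size of order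
  \<open>\<kappa> n j\<^sup>2\<close>, which exceeds \<open>n\<close> at radius \<open>O(1 / sqrt \<kappa>)\<close>.\<close>

lemma thin_boundary:
  assumes fin: "finite W" and v: "v \<in> W" and d: "0 \<le> d"
    and n: "real (card W) \<le> n" "0 < n" and kappa: "0 < \<kappa>"
    and deg: "\<kappa> * n \<le> real (card (nbrs E W v))" and J: "4 < \<kappa> * (real J + 1) ^ 2"
  shows "\<exists>r. 1 \<le> r \<and> r \<le> 2 * J \<and>
    real (card (rlayer E W d v r)) * real (card (rlayer E W d v (Suc r))) \<le> \<kappa> * n * real (card (rball E W d v r))"
proof (rule ccontr)
  assume neg: "\<not> ?thesis"
  have one: "\<kappa> * n \<le> real (card (rball E W d v 1))"
    using deg card_mono[OF finite_rball[OF fin v d] nbrs_subset_rball_1[OF fin v d], of E]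
    by simp
  have thick: "\<kappa> * n * real (card (rball E W d v r)) < real (card (rlayer E W d v r)) * real (card (rlayer E W d v (Suc r)))"
    if "1 \<le> r" "r \<le> 2 * J" for r
    using neg that by (meson not_le)
  \<comment> \<open>By the choice of \<open>J\<close> the left-hand side exceeds
    \<open>n\<close>.\<close>
  have "\<kappa> * n * ((real J + 1) / 2) ^ 2 \<le> real (card (rball E W d v (2 * J + 1)))"
    using n kappa one thick
    by (intro ball_growth[where l = "\<lambda>i. real (card (rlayer E W d v i))" and J = J])
       (simp_all add: card_rball_Suc[OF fin v d])
  also have "\<dots> \<le> n"
    using card_mono[OF fin rball_subset[OF fin v d, of E "2 * J + 1"]] n by linarith
  finally have "n * (\<kappa> * (real J + 1) ^ 2) \<le> n * 4" by (simp add: power2_eq_square field_simps)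
  then show False using J n by simp
qed

text \<open>Vertices whose degree suffices for \<open>thin_boundary\<close>, but near which some
  layer may have too many inner edges for the parity colouring.\<close>

definition bad :: "'a set set \<Rightarrow> 'a set \<Rightarrow> real \<Rightarrow> real \<Rightarrow> nat \<Rightarrow> 'a set" where
  "bad E W d m R = {v \<in> W. m \<le> real (card (nbrs E W v)) \<and> (\<exists>i\<le>R. d \<le> real (card (heavy E W d v i)))}"

text \<open>Induction on \<open>W\<close>: cut off a ball around a vertex that is not bad and
  continue in the rest, with \<open>few\<close> available for every remaining set. Of the
  \<open>2 * \<kappa> * n\<close> deletions allowed per vertex, one half pays for the thin boundary
  and the other, by \<open>small\<close>, for the remaining terms.\<close>

lemma near_bipartite:
  fixes E :: "'a set set"
  assumes V: "finite V" "real (card V) \<le> n" "0 < n" and d: "0 \<le> d" and kappa: "0 < \<kappa>"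
    and J: "4 < \<kappa> * (real J + 1) ^ 2" and small: "(2 * real J + 1) * d / \<kappa> + 2 * d \<le> \<kappa> * n"
    and few: "\<And>W. W \<subseteq> V \<Longrightarrow> real (card (bad E W d (\<kappa> * n) (2 * J))) \<le> d"
    and W: "W \<subseteq> V"
  shows "\<exists>D col. finite D \<and> real (card D) \<le> 2 * \<kappa> * n * real (card W) \<and>
    (\<forall>u\<in>W. \<forall>x\<in>W. {u, x} \<in> E \<longrightarrow> {u, x} \<notin> D \<longrightarrow> col u \<noteq> (col x :: bool))"
proof -
  have "finite W" using W V(1) by (rule finite_subset)
  then show ?thesis using W
  proof (induction W rule: finite_psubset_induct)
    case (psubset W)
    note fin = psubset.hyps(1)
    have Wn: "real (card W) \<le> n" using card_mono[OF V(1) psubset.prems] V(2) by simp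
    show ?case
    proof (cases "\<exists>v\<in>W. \<kappa> * n \<le> real (card (nbrs E W v)) \<and> v \<notin> bad E W d (\<kappa> * n) (2 * J)")
      case True
      then obtain v where v: "v \<in> W" "\<kappa> * n \<le> real (card (nbrs E W v))"
        and light: "\<And>i. i \<le> 2 * J \<Longrightarrow> real (card (heavy E W d v i)) \<le> d"
        unfolding bad_def by force
      obtain r where r: "1 \<le> r" "r \<le> 2 * J"
        and thin: "real (card (rlayer E W d v r)) * real (card (rlayer E W d v (Suc r)))
          \<le> \<kappa> * n * real (card (rball E W d v r))"
        using thin_boundary[OF fin v(1) d Wn V(3) kappa v(2) J] by blast
      let ?B = "rball E W d v r"
      have sub: "?B \<subseteq> W" by (rule rball_subset[OF fin v(1) d])
      have "\<And>i. i \<le> r \<Longrightarrow> real (card (heavy E W d v i)) \<le> d" using light r by simp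
      from colour_ball[OF fin v(1) d this] obtain D1 and col1 :: "'a \<Rightarrow> bool" where D1: "finite D1"
        "real (card D1) \<le> real (card W) * (real r + 1) * d
           + real (card (rlayer E W d v r)) * real (card (rlayer E W d v (Suc r))) + 2 * d * real (card ?B)"
        "\<And>u x. u \<in> W \<Longrightarrow> x \<in> ?B \<Longrightarrow> {u, x} \<in> E \<Longrightarrow> {u, x} \<notin> D1 \<Longrightarrow> u \<in> ?B \<and> col1 u \<noteq> col1 x"
        by blast
      have "v \<in> ?B" using rlayer_0[of E W d v] by (force simp: rball_UN)
      then have "W - ?B \<subset> W" "W - ?B \<subseteq> V" using v(1) psubset.prems by auto
      from psubset.IH[OF this] obtain D2 and col2 :: "'a \<Rightarrow> bool" where D2: "finite D2"
        "real (card D2) \<le> 2 * \<kappa> * n * real (card (W - ?B))"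
        "\<And>u x. u \<in> W - ?B \<Longrightarrow> x \<in> W - ?B \<Longrightarrow> {u, x} \<in> E \<Longrightarrow> {u, x} \<notin> D2 \<Longrightarrow> col2 u \<noteq> col2 x"
        by blast
      have "\<kappa> * n \<le> real (card ?B)"
      proof -
        have "rball E W d v 1 \<subseteq> ?B" unfolding rball_UN using r by (intro UN_mono) auto
        then have "nbrs E W v \<subseteq> ?B" using nbrs_subset_rball_1[OF fin v(1) d, of E] by blast
        then show ?thesis
          using card_mono[OF finite_rball[OF fin v(1) d], of "nbrs E W v" E r] v(2) by linarith
      qed
      \<comment> \<open>This lets the term proportional to \<open>card W\<close> be charged to the
        vertices of the ball alone.\<close>
      then have "n \<le> real (card ?B) / \<kappa>" using kappa by (simp add: field_simps)
      have "real (card W) * (real r + 1) * d \<le> real (card ?B) / \<kappa> * (2 * real J + 1) * d"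
        using \<open>n \<le> real (card ?B) / \<kappa>\<close> Wn r d by (intro mult_right_mono mult_mono) auto
      moreover have "real (card ?B) * ((2 * real J + 1) * d / \<kappa> + 2 * d) \<le> real (card ?B) * (\<kappa> * n)"
        using small by (intro mult_left_mono) auto
      ultimately have "real (card D1) \<le> 2 * \<kappa> * n * real (card ?B)"
        using D1(2) thin by (simp add: algebra_simps)
      moreover have "real (card W) = real (card (W - ?B)) + real (card ?B)"
        using card_Diff_subset[OF finite_subset[OF sub fin] sub] card_mono[OF fin sub] by simp
      moreover have "real (card (D1 \<union> D2)) \<le> real (card D1) + real (card D2)"
        using card_Un_le[of D1 D2] by linarith
      ultimately have "real (card (D1 \<union> D2)) \<le> 2 * \<kappa> * n * real (card W)"
        using D2(2) by (simp add: algebra_simps)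
      moreover have "(if u \<in> ?B then col1 u else col2 u) \<noteq> (if x \<in> ?B then col1 x else col2 x)"
        if ux: "u \<in> W" "x \<in> W" "{u, x} \<in> E" "{u, x} \<notin> D1 \<union> D2" for u x
      proof -
        have xu: "{x, u} = {u, x}" by blast
        note c = D1(3)[of u x] D1(3)[of x u, unfolded xu] D2(3)[of u x]
        show ?thesis using c ux by (cases "u \<in> ?B"; cases "x \<in> ?B") simp_all
      qed
      ultimately show ?thesis using D1(1) D2(1)
        by (intro exI[of _ "D1 \<union> D2"] exI[of _ "\<lambda>u. if u \<in> ?B then col1 u else col2 u"]) auto
    next
      case False
      let ?bad = "bad E W d (\<kappa> * n) (2 * J)"
      \<comment> \<open>Every vertex now has low degree or is one of the few bad ones, so all edges
        within \<open>W\<close> can be deleted.\<close>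
      define D where "D = (\<Union>u\<in>W. (\<lambda>x. {u, x}) ` nbrs E W u)"
      have finN: "finite (nbrs E W u)" for u using fin by (simp add: nbrs_def)
      have "real (card D) \<le> (\<Sum>u\<in>W. real (card (nbrs E W u)))"
        unfolding D_def by (rule card_UN_image_le[OF fin finN])
      also have "\<dots> \<le> (\<Sum>u\<in>W. (if u \<in> ?bad then real (card W) else 0) + \<kappa> * n)"
      proof (rule sum_mono)
        fix u assume u: "u \<in> W"
        have "card (nbrs E W u) \<le> card W" using fin by (intro card_mono) (auto simp: nbrs_def)
        moreover have "0 < \<kappa> * n" using kappa V(3) by simp
        ultimately show "real (card (nbrs E W u)) \<le> (if u \<in> ?bad then real (card W) else 0) + \<kappa> * n"
          using False u by fastforce
      qed
      also have "\<dots> = real (card ?bad) * real (card W) + real (card W) * (\<kappa> * n)"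
      proof -
        have "W \<inter> {u. u \<in> ?bad} = ?bad" by (auto simp: bad_def)
        then show ?thesis using fin by (simp add: sum.distrib sum.If_cases)
      qed
      also have "real (card ?bad) * real (card W) \<le> (\<kappa> * n) * real (card W)"
      proof (rule mult_right_mono)
        have "0 \<le> (2 * real J + 1) * d / \<kappa>" using d kappa by simp
        then show "real (card ?bad) \<le> \<kappa> * n" using few[OF psubset.prems] small d by linarith
      qed simp
      finally have "real (card D) \<le> 2 * \<kappa> * n * real (card W)" by (simp add: algebra_simps)
      moreover have "{u, x} \<in> D" if "u \<in> W" "x \<in> W" "{u, x} \<in> E" for u x
        using that by (auto simp: D_def nbrs_def)
      moreover have "finite D" using fin finN by (simp add: D_def)
      ultimately show ?thesis by (intro exI[of _ D]) auto
    qed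
  qed
qed

text \<open>A sample that meets every large set of one of the three kinds below contains a vertex \<open>v\<close> of
  \<open>bad\<close>, an edge within a layer of \<open>v\<close>, and paths from both of its ends back to \<open>v\<close>.\<close>

lemma odd_walk_in_sample:
  fixes E :: "'a set set"
  assumes hit_bad: "S \<inter> bad E W d m R \<noteq> {}"
    and hit_heavy: "\<And>v i. v \<in> S \<Longrightarrow> i \<le> R \<Longrightarrow> d \<le> real (card (heavy E W d v i)) \<Longrightarrow> S \<inter> heavy E W d v i \<noteq> {}"
    and hit_nbrs: "\<And>v u i. v \<in> S \<Longrightarrow> u \<in> S \<Longrightarrow> i \<le> R \<Longrightarrow> d \<le> real (card (nbrs E (rlayer E W d v i) u)) \<Longrightarrow>
      S \<inter> nbrs E (rlayer E W d v i) u \<noteq> {}"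
  obtains i v where "i \<le> R" "(v, v) \<in> arcs {e \<in> E. e \<subseteq> S} ^^ (2 * i + 1)"
proof -
  obtain v i where v: "v \<in> S" "i \<le> R" "d \<le> real (card (heavy E W d v i))"
    using hit_bad by (auto simp: bad_def)
  let ?r = "arcs {e \<in> E. e \<subseteq> S}"
  have path: "(u, v) \<in> ?r ^^ j" if "j \<le> R" "u \<in> S" "u \<in> rlayer E W d v j" for u j
    using that
  proof (induction j arbitrary: u)
    case 0
    then show ?case by (simp add: rlayer_0)
  next
    case (Suc j)
    have "\<exists>x. x \<in> S \<and> x \<in> nbrs E (rlayer E W d v j) u"
    \<comment> \<open>A vertex of layer 1 needs only one neighbour in layer 0; this is
      \<open>v\<close>, which is in the sample.\<close>
    proof (cases "j = 0")
      case True
      then have "nbrs E {v} u \<noteq> {}" using Suc.prems(3) by (auto simp: rlayer_Suc rlayer_0)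
      then show ?thesis using v(1) True by (auto simp: nbrs_def rlayer_0)
    next
      case False
      then have "d \<le> real (card (nbrs E (rlayer E W d v j) u))" using Suc.prems(3) by (auto simp: rlayer_Suc)
      then show ?thesis using hit_nbrs[OF v(1) Suc.prems(2), of j] Suc.prems(1) by auto
    qed
    then obtain x where x: "x \<in> S" "x \<in> rlayer E W d v j" "{u, x} \<in> E" by (auto simp: nbrs_def)
    then have "(x, v) \<in> ?r ^^ j" using Suc by simp
    moreover have "(u, x) \<in> ?r" using x Suc.prems(2) by simp
    ultimately show ?case by (rule relpow_Suc_I2[rotated])
  qed
  obtain u where u: "u \<in> S" "u \<in> heavy E W d v i" using hit_heavy[OF v] by blast
  obtain x where x: "x \<in> S" "x \<in> nbrs E (rlayer E W d v i) u"
    using hit_nbrs[OF v(1) u(1) v(2)] u(2) by (auto simp: heavy_def)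
  have "(u, v) \<in> ?r ^^ i" "(x, v) \<in> ?r ^^ i"
    using path[OF v(2)] u x by (auto simp: heavy_def nbrs_def)
  then have "(v, u) \<in> ?r ^^ i" "(x, v) \<in> ?r ^^ i" by (auto intro: arcs_relpow_sym)
  moreover have "(u, x) \<in> ?r" using u x by (auto simp: nbrs_def)
  ultimately have "(v, v) \<in> ?r ^^ (Suc i + i)" by (meson relpow_Suc_I relpow_trans)
  moreover have "Suc i + i = 2 * i + 1" by simp
  ultimately show ?thesis using that v(2) by metis
qed

section \<open>Random samples hit large sets\<close>

text \<open>The quotient of the binomials is a product of factors \<open>(a - i) / (b - i)\<close>,
  each at most \<open>a / b\<close>.\<close>

lemma choose_times_power_le:
  assumes "a \<le> b"
  shows "(a choose m) * b ^ m \<le> (b choose m) * a ^ m"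
proof (induction m)
  case (Suc m)
  have step: "(n choose Suc m) * Suc m = (n choose m) * (n - m)" for n
  proof (cases "Suc m \<le> n")
    case True
    then show ?thesis using choose_mult[of m "Suc m" n] by simp
  next
    case False
    then show ?thesis by (simp add: binomial_eq_0)
  qed
  have "(a - m) * b \<le> (b - m) * a"
    unfolding diff_mult_distrib mult.commute[of b a] using assms by (intro diff_le_mono2 mult_le_mono2)
  then have "((a choose m) * b ^ m) * ((a - m) * b) \<le> ((b choose m) * a ^ m) * ((b - m) * a)"
    by (rule mult_le_mono[OF Suc.IH])
  then have "((a choose m) * (a - m)) * b ^ Suc m \<le> ((b choose m) * (b - m)) * a ^ Suc m"
    by (simp add: mult_ac)
  then have "Suc m * ((a choose Suc m) * b ^ Suc m) \<le> Suc m * ((b choose Suc m) * a ^ Suc m)"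
    unfolding step[symmetric] by (simp only: mult_ac)
  then show ?case by (simp only: Suc_mult_le_cancel1)
qed simp

text \<open>Removing \<open>T\<close> leaves \<open>w - 2\<close> vertices outside \<open>A\<close>.
  The pair is fixed because the sets to be hit will depend on up to two sampled vertices.\<close>

lemma card_subsets_avoiding_le:
  assumes V: "finite V" and T: "T \<subseteq> V" "card T = 2" and A: "A \<subseteq> V" and w: "2 \<le> w"
    and large: "\<delta> * real (card V) \<le> real (card A)" "4 \<le> \<delta> * real (card V)" and delta: "0 < \<delta>" "\<delta> \<le> 1"
  shows "real (card {S. S \<subseteq> V \<and> card S = w \<and> T \<subseteq> S \<and> S \<inter> A = {}})
    \<le> (1 - \<delta> / 2) ^ (w - 2) * real ((card V - 2) choose (w - 2))"
proof -
  let ?n = "card V" and ?X = "{S. S \<subseteq> V \<and> card S = w \<and> T \<subseteq> S \<and> S \<inter> A = {}}"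
  have finT: "finite T" using T V by (meson finite_subset)
  have aV: "card A \<le> ?n" using A V by (rule card_mono[rotated])
  have a4: "4 \<le> real (card A)" using large by linarith
  have n: "2 < ?n" using a4 aV by linarith
  have "inj_on (\<lambda>S. S - T) ?X" by (rule inj_onI) blast
  moreover have "(\<lambda>S. S - T) ` ?X \<subseteq> {S. S \<subseteq> V - A \<and> card S = w - 2}"
    using T finT by (auto simp: card_Diff_subset)
  moreover have "finite {S. S \<subseteq> V - A \<and> card S = w - 2}" using V by simp
  ultimately have "card ?X \<le> card {S. S \<subseteq> V - A \<and> card S = w - 2}" by (rule card_inj_on_le)
  also have "\<dots> = (?n - card A) choose (w - 2)"
    using V A by (subst n_subsets) (simp_all add: card_Diff_subset finite_subset)
  finally have X: "card ?X \<le> (?n - card A) choose (w - 2)" .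
  have "((?n - card A) choose (w - 2)) * (?n - 2) ^ (w - 2) \<le> ((?n - 2) choose (w - 2)) * (?n - card A) ^ (w - 2)"
    using a4 by (intro choose_times_power_le) linarith
  then have "real (((?n - card A) choose (w - 2)) * (?n - 2) ^ (w - 2)) \<le> real (((?n - 2) choose (w - 2)) * (?n - card A) ^ (w - 2))"
    by (simp only: of_nat_le_iff)
  then have "real ((?n - card A) choose (w - 2)) * real (?n - 2) ^ (w - 2) \<le> real ((?n - 2) choose (w - 2)) * real (?n - card A) ^ (w - 2)"
    by simp
  also have "\<dots> \<le> real ((?n - 2) choose (w - 2)) * ((1 - \<delta> / 2) * real (?n - 2)) ^ (w - 2)"
  proof (intro mult_left_mono power_mono)
    \<comment> \<open>Half of \<open>\<delta> * card V\<close> is at least 2 and absorbs the two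
      vertices of \<open>T\<close>.\<close>
    have "real (?n - card A) = real ?n - real (card A)" "real (?n - 2) = real ?n - 2" using aV n by auto
    then show "real (?n - card A) \<le> (1 - \<delta> / 2) * real (?n - 2)"
      using large delta by (simp add: algebra_simps)
  qed auto
  also have "\<dots> = (1 - \<delta> / 2) ^ (w - 2) * real ((?n - 2) choose (w - 2)) * real (?n - 2) ^ (w - 2)"
    by (simp add: power_mult_distrib)
  finally have "real ((?n - card A) choose (w - 2)) \<le> (1 - \<delta> / 2) ^ (w - 2) * real ((?n - 2) choose (w - 2))"
    using n by (simp add: mult_le_cancel_right)
  then show ?thesis using X by (meson of_nat_le_iff order.trans)
qed

text \<open>Union bound over \<open>T\<close> and the sets in \<open>\<A> T\<close>. Double counting
  pairs inside samples replaces the number of pairs in \<open>V\<close> by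
  \<open>w choose 2\<close>, independent of the graph.\<close>

lemma card_subsets_missing_le:
  assumes V: "finite V" and w: "2 \<le> w" "w \<le> card V"
    and large: "4 \<le> \<delta> * real (card V)" and delta: "0 < \<delta>" "\<delta> \<le> 1"
    and A: "\<And>T. T \<subseteq> V \<Longrightarrow> card T = 2 \<Longrightarrow> finite (\<A> T) \<and> card (\<A> T) \<le> q"
      "\<And>T X. T \<subseteq> V \<Longrightarrow> card T = 2 \<Longrightarrow> X \<in> \<A> T \<Longrightarrow> X \<subseteq> V \<and> \<delta> * real (card V) \<le> real (card X)"
  shows "real (card {S. S \<subseteq> V \<and> card S = w \<and> (\<exists>T \<subseteq> S. card T = 2 \<and> (\<exists>X\<in>\<A> T. S \<inter> X = {}))})
    \<le> real (card V choose w) * (real q * real (w choose 2) * (1 - \<delta> / 2) ^ (w - 2))"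
proof -
  let ?F = "{S. S \<subseteq> V \<and> card S = w \<and> (\<exists>T \<subseteq> S. card T = 2 \<and> (\<exists>X\<in>\<A> T. S \<inter> X = {}))}"
  let ?P = "{T. T \<subseteq> V \<and> card T = 2}"
  let ?G = "\<lambda>T X. {S. S \<subseteq> V \<and> card S = w \<and> T \<subseteq> S \<and> S \<inter> X = {}}"
  let ?b = "(1 - \<delta> / 2) ^ (w - 2) * real ((card V - 2) choose (w - 2))"
  have b0: "0 \<le> ?b" using delta by simp
  have finP: "finite ?P" using V by simp
  have "?F \<subseteq> (\<Union>T\<in>?P. \<Union>X\<in>\<A> T. ?G T X)" by blast
  moreover have "finite (\<Union>T\<in>?P. \<Union>X\<in>\<A> T. ?G T X)"
    by (rule finite_subset[of _ "Pow V"]) (use V in auto)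
  ultimately have "card ?F \<le> card (\<Union>T\<in>?P. \<Union>X\<in>\<A> T. ?G T X)" by (intro card_mono)
  also have "\<dots> \<le> (\<Sum>T\<in>?P. card (\<Union>X\<in>\<A> T. ?G T X))" using finP by (rule card_UN_le)
  also have "\<dots> \<le> (\<Sum>T\<in>?P. \<Sum>X\<in>\<A> T. card (?G T X))"
    using A(1) by (intro sum_mono card_UN_le) auto
  finally have "real (card ?F) \<le> real (\<Sum>T\<in>?P. \<Sum>X\<in>\<A> T. card (?G T X))" by (simp only: of_nat_le_iff)
  also have "\<dots> = (\<Sum>T\<in>?P. \<Sum>X\<in>\<A> T. real (card (?G T X)))" by simp
  also have "\<dots> \<le> (\<Sum>T\<in>?P. real q * ?b)"
  proof (rule sum_mono)
    fix T assume T: "T \<in> ?P"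
    have "(\<Sum>X\<in>\<A> T. real (card (?G T X))) \<le> real (card (\<A> T)) * ?b"
    proof (rule sum_bounded_above)
      fix X assume "X \<in> \<A> T"
      then show "real (card (?G T X)) \<le> ?b"
        using A(2)[of T X] T V w(1) large delta by (intro card_subsets_avoiding_le) auto
    qed
    also have "\<dots> \<le> real q * ?b" using A(1)[of T] T b0 by (intro mult_right_mono) auto
    finally show "(\<Sum>X\<in>\<A> T. real (card (?G T X))) \<le> real q * ?b" .
  qed
  also have "\<dots> = real q * (1 - \<delta> / 2) ^ (w - 2) * real ((card V choose 2) * ((card V - 2) choose (w - 2)))"
    using n_subsets[OF V, of 2] by simp
  also have "(card V choose 2) * ((card V - 2) choose (w - 2)) = (card V choose w) * (w choose 2)"
    using choose_mult[OF w] by simp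
  finally show ?thesis by (simp add: mult_ac)
qed

text \<open>From \<open>1 - x \<le> exp (- x)\<close> and \<open>exp y \<ge> (y / 3) ^ 3\<close>.
  Cubic decay is enough to beat the quadratic number of pairs in a sample.\<close>

lemma power_one_minus_le:
  assumes "0 < x" "x \<le> 1" "0 < m"
  shows "(1 - x) ^ m \<le> 27 / (x * real m) ^ 3"
proof -
  have "(1 - x) ^ m \<le> exp (- x) ^ m"
    using assms exp_ge_add_one_self[of "- x"] by (intro power_mono) auto
  also have "\<dots> = 1 / exp (x * real m)"
    by (simp add: exp_minus exp_of_nat_mult[symmetric] mult.commute inverse_eq_divide power_one_over)
  also have "\<dots> \<le> 1 / (x * real m / 3) ^ 3"
  proof (intro divide_left_mono)
    have "(x * real m / 3) ^ 3 \<le> (1 + x * real m / real 3) ^ 3" using assms by (intro power_mono) auto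
    also have "\<dots> \<le> exp (x * real m)"
      using assms by (intro exp_ge_one_plus_x_over_n_power_n) (auto intro: order_trans[of _ 0])
    finally show "(x * real m / 3) ^ 3 \<le> exp (x * real m)" .
  qed (use assms in auto)
  also have "\<dots> = 27 / (x * real m) ^ 3" by (simp add: power_divide)
  finally show ?thesis .
qed

text \<open>Replacing \<open>w - 2\<close> by \<open>w / 2\<close> gives
  \<open>1728 = 27 * 4^3\<close>; the factor \<open>w^2 / 2\<close> leaves
  \<open>864 * q / (\<delta>^3 * w)\<close>, and \<open>2592 = 3 * 864\<close>.\<close>

lemma failure_bound:
  assumes delta: "0 < \<delta>" "\<delta> \<le> 1" and q: "1 \<le> q" and w: "2592 * q / \<delta> ^ 3 \<le> real w"
  shows "q * real (w choose 2) * (1 - \<delta> / 2) ^ (w - 2) \<le> 1 / 3"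
proof -
  have "1 * 1 \<le> q * (1 / \<delta> ^ 3)" using q delta by (intro mult_mono) (auto simp: power_le_one)
  then have "2592 \<le> real w" using w by simp
  then have w4: "4 \<le> w" by linarith
  define m where "m = w - 2"
  have m: "real w / 2 \<le> real m" "0 < m" using w4 by (auto simp: m_def)
  have "(1 - \<delta> / 2) ^ m \<le> 27 / (\<delta> / 2 * real m) ^ 3"
    using delta m by (intro power_one_minus_le) auto
  also have "\<dots> \<le> 27 / (\<delta> / 2 * (real w / 2)) ^ 3"
    using delta m w4 by (intro divide_left_mono power_mono mult_left_mono mult_pos_pos zero_less_power) auto
  also have "\<dots> = 1728 / (\<delta> ^ 3 * real w ^ 3)" by (simp add: power_divide power_mult_distrib)
  finally have p: "(1 - \<delta> / 2) ^ m \<le> 1728 / (\<delta> ^ 3 * real w ^ 3)" .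
  have "real (w choose 2) \<le> real w ^ 2 / 2"
  proof -
    have "2 * (w choose 2) \<le> w * w" using times_binomial_minus1_eq[of 2 w] by simp
    then have "real (2 * (w choose 2)) \<le> real (w * w)" by (simp only: of_nat_le_iff)
    then show ?thesis by (simp add: power2_eq_square)
  qed
  then have "q * real (w choose 2) * (1 - \<delta> / 2) ^ m \<le> q * (real w ^ 2 / 2) * (1728 / (\<delta> ^ 3 * real w ^ 3))"
    using p q delta by (intro mult_mono) auto
  also have "\<dots> = 864 * q / (\<delta> ^ 3 * real w)"
    using w4 delta by (simp add: field_simps power2_eq_square power3_eq_cube)
  also have "\<dots> \<le> 1 / 3"
    using w w4 delta by (simp add: field_simps)
  finally show ?thesis by (simp add: m_def)
qed

section \<open>The witness size\<close>

text \<open>Layer 0 is \<open>{v}\<close>, and a sampled \<open>v\<close> may lie outside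
  \<open>W\<close>.\<close>

lemma rlayer_subset_insert: "rlayer E W d v i \<subseteq> insert v W"
  by (cases i) (auto simp: rlayer_0 rlayer_Suc)

text \<open>All sets that \<open>odd_walk_in_sample\<close> may ask the sample to meet on account of
  the vertices in \<open>T\<close>.\<close>

definition targets :: "'a set set \<Rightarrow> 'a set \<Rightarrow> real \<Rightarrow> real \<Rightarrow> nat \<Rightarrow> 'a set \<Rightarrow> 'a set set" where
  "targets E W d m R T =
    {bad E W d m R} \<union> (\<lambda>(v, i). heavy E W d v i) ` (T \<times> {..R})
      \<union> (\<lambda>(v, u, i). nbrs E (rlayer E W d v i) u) ` (T \<times> T \<times> {..R})"

lemma card_targets:
  assumes "card T = 2"
  shows "finite (targets E W d m R T)" "card (targets E W d m R T) \<le> 6 * R + 7"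
proof -
  have T: "finite T" using assms by (metis card.infinite zero_neq_numeral)
  let ?A = "(\<lambda>(v, i). heavy E W d v i) ` (T \<times> {..R})"
    and ?B = "(\<lambda>(v, u, i). nbrs E (rlayer E W d v i) u) ` (T \<times> T \<times> {..R})"
  have "card ?A \<le> card (T \<times> {..R})" "card ?B \<le> card (T \<times> T \<times> {..R})"
    using T by (intro card_image_le; simp)+
  then have AB: "card ?A \<le> 2 * (R + 1)" "card ?B \<le> 4 * (R + 1)" using assms by (simp_all add: card_cartesian_product)
  have "card (targets E W d m R T) \<le> card ({bad E W d m R} \<union> ?A) + card ?B"
    unfolding targets_def by (rule card_Un_le)
  also have "card ({bad E W d m R} \<union> ?A) \<le> card {bad E W d m R} + card ?A" by (rule card_Un_le)
  finally show "card (targets E W d m R T) \<le> 6 * R + 7" using AB by simp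
  show "finite (targets E W d m R T)" using T by (simp add: targets_def)
qed

lemma targets_subset:
  assumes "X \<in> targets E W d m R T" "T \<subseteq> V" "W \<subseteq> V"
  shows "X \<subseteq> V"
proof -
  have "rlayer E W d v i \<subseteq> V" if "v \<in> T" for v i
    using rlayer_subset_insert[of E W d v i] that assms(2,3) by blast
  then show ?thesis using assms unfolding targets_def by (fastforce simp: bad_def heavy_def nbrs_def)
qed

text \<open>\<open>u\<close> and \<open>v\<close> may coincide, in which case the pair is filled up
  from the sample.\<close>

lemma pair_in_sample:
  assumes "u \<in> S" "v \<in> S" "2 \<le> card S"
  obtains T where "T \<subseteq> S" "card T = 2" "u \<in> T" "v \<in> T"
proof -
  have fin: "finite S" using assms(3) by (metis card.infinite not_numeral_le_zero)
  have "card {u, v} \<le> 2" by (simp add: card_insert_if)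
  moreover have "{u, v} \<subseteq> S" using assms by simp
  ultimately obtain T where "{u, v} \<subseteq> T" "T \<subseteq> S" "card T = 2"
    using exists_subset_between[of "{u, v}" 2 S] assms(3) fin by metis
  then show ?thesis using that by blast
qed

text \<open>A sample that meets every target of size at least \<open>d\<close> contains the walk by
  \<open>odd_walk_in_sample\<close>; by the union bound at most a third of the samples miss
  one.\<close>

lemma odd_walk_in_most_samples:
  assumes E: "W \<subseteq> V" "finite V" and d: "d = \<delta> * real (card V)" and bad: "d \<le> real (card (bad E W d m R))"
    and w: "w \<le> card V" "2592 * real (6 * R + 7) / \<delta> ^ 3 \<le> real w"
    and delta: "0 < \<delta>" "\<delta> \<le> 1" "4 \<le> \<delta> * real (card V)"
  shows "2 / 3 * real (card V choose w) \<le>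
    real (card {S. S \<subseteq> V \<and> card S = w \<and> (\<exists>i v. i \<le> R \<and> (v, v) \<in> arcs {e \<in> E. e \<subseteq> S} ^^ (2 * i + 1))})"
proof -
  define \<A> where "\<A> T = {X \<in> targets E W d m R T. d \<le> real (card X)}" for T
  let ?all = "{S. S \<subseteq> V \<and> card S = w}"
  let ?miss = "{S. S \<subseteq> V \<and> card S = w \<and> (\<exists>T \<subseteq> S. card T = 2 \<and> (\<exists>X\<in>\<A> T. S \<inter> X = {}))}"
  let ?walk = "{S. S \<subseteq> V \<and> card S = w \<and> (\<exists>i v. i \<le> R \<and> (v, v) \<in> arcs {e \<in> E. e \<subseteq> S} ^^ (2 * i + 1))}"
  have "2592 * 1 \<le> 2592 * (real (6 * R + 7) / \<delta> ^ 3)"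
    using delta by (intro mult_left_mono) (auto simp: le_divide_eq intro: order_trans[OF power_le_one])
  then have "2592 \<le> real w" using w(2) by simp
  then have w2: "2 \<le> w" by linarith
  have "?all - ?miss \<subseteq> ?walk"
  proof
    fix S assume S: "S \<in> ?all - ?miss"
    then have cS: "card S = w" "S \<subseteq> V" by auto
    have hit: "S \<inter> X \<noteq> {}" if "T \<subseteq> S" "card T = 2" "X \<in> targets E W d m R T" "d \<le> real (card X)" for T X
    proof
      assume "S \<inter> X = {}"
      moreover have "X \<in> \<A> T" using that by (simp add: \<A>_def)
      ultimately show False using S that(1,2) by blast
    qed
    have hit2: "S \<inter> X \<noteq> {}" if "v \<in> S" "u \<in> S" "d \<le> real (card X)"
        "\<And>T. v \<in> T \<Longrightarrow> u \<in> T \<Longrightarrow> X \<in> targets E W d m R T" for v u X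
      using pair_in_sample[of v S u] hit that cS(1) w2 by metis
    obtain z where z: "z \<in> S" using cS w2 by fastforce
    have "S \<inter> bad E W d m R \<noteq> {}"
      using hit2[OF z z bad] by (auto simp: targets_def)
    moreover have "S \<inter> heavy E W d v i \<noteq> {}" if "v \<in> S" "i \<le> R" "d \<le> real (card (heavy E W d v i))" for v i
      using that by (intro hit2[of v v]) (auto simp: targets_def)
    moreover have "S \<inter> nbrs E (rlayer E W d v i) u \<noteq> {}"
      if "v \<in> S" "u \<in> S" "i \<le> R" "d \<le> real (card (nbrs E (rlayer E W d v i) u))" for v u i
      using that by (intro hit2[of v u]) (force simp: targets_def)+
    ultimately obtain i v where "i \<le> R" "(v, v) \<in> arcs {e \<in> E. e \<subseteq> S} ^^ (2 * i + 1)"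
      by (rule odd_walk_in_sample)
    then show "S \<in> ?walk" using cS by blast
  qed
  then have "?all \<subseteq> ?walk \<union> ?miss" by blast
  moreover have "finite (?walk \<union> ?miss)" by (rule finite_subset[of _ "Pow V"]) (use E in auto)
  ultimately have "card ?all \<le> card (?walk \<union> ?miss)" by (intro card_mono)
  also have "\<dots> \<le> card ?walk + card ?miss" by (rule card_Un_le)
  finally have "real (card V choose w) \<le> real (card ?walk) + real (card ?miss)"
    by (simp add: n_subsets[OF E(2)] flip: of_nat_add)
  moreover have "real (card ?miss) \<le> real (card V choose w) * (1 / 3)"
  proof -
    have "finite (\<A> T) \<and> card (\<A> T) \<le> 6 * R + 7" if "card T = 2" for T
    proof -
      have "\<A> T \<subseteq> targets E W d m R T" by (auto simp: \<A>_def)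
      then show ?thesis using card_targets[OF that, of E W d m R] by (meson card_mono finite_subset le_trans)
    qed
    moreover have "X \<subseteq> V \<and> \<delta> * real (card V) \<le> real (card X)" if "T \<subseteq> V" "X \<in> \<A> T" for T X
      using that(2) targets_subset[OF _ that(1) E(1), of X E d m R] by (simp add: \<A>_def d)
    ultimately have "real (card ?miss) \<le> real (card V choose w) *
        (real (6 * R + 7) * real (w choose 2) * (1 - \<delta> / 2) ^ (w - 2))"
      by (intro card_subsets_missing_le E w2 w delta) auto
    also have "\<dots> \<le> real (card V choose w) * (1 / 3)"
      using failure_bound[OF delta(1,2) _ w(2)] by (intro mult_left_mono) auto
    finally show ?thesis .
  qed
  ultimately show ?thesis by linarith
qed

lemma two_coloured_in_slow_odd_girth:
  assumes "simple_graph G" "\<And>u x. {u, x} \<in> edges G \<Longrightarrow> col u \<noteq> (col x :: bool)"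
  shows "G \<in> slow_odd_girth g"
  using assms two_coloured_walk_parity[of _ _ _ "edges G" col] by (fastforce simp: slow_odd_girth_def)

text \<open>With \<open>\<kappa> = \<epsilon> / 4\<close>, few bad vertices in every
  \<open>W\<close> would make the graph bipartite after \<open>\<epsilon> / 2 * n^2\<close>
  deletions, too few for a far graph. So some \<open>W\<close> has many, and radius
  \<open>2 * J\<close> gives \<open>6 * (2 * J) + 7\<close> targets per pair.\<close>

lemma sample_size_suffices_slow_odd_girth:
  assumes eps: "0 < \<epsilon>" "\<epsilon> < 1" and delta: "\<delta> = \<epsilon> ^ 3 / 200"
    and J: "16 < \<epsilon> * (real J + 1) ^ 2" "(2 * real J + 1) * \<epsilon> \<le> 11"
    and w: "2592 * real (12 * J + 7) / \<delta> ^ 3 \<le> real w"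
    and g: "\<And>i. i \<le> 2 * J \<Longrightarrow> g (2 * i + 1) \<le> w"
  shows "sample_size_suffices (slow_odd_girth g) \<epsilon> w"
  unfolding sample_size_suffices_def
proof (intro exI allI impI)
  fix G assume G: "simple_graph G" and N: "nat \<lceil>4 / \<delta>\<rceil> + w + 1 \<le> card (verts G)"
    and far: "eps_far \<epsilon> (slow_odd_girth g) G"
  define V E n where "V = verts G" and "E = edges G" and "n = real (card V)"
  have delta01: "0 < \<delta>" "\<delta> \<le> 1" using eps power_le_one[of \<epsilon> 3] by (auto simp: delta)
  have finV: "finite V" using G by (simp add: simple_graph_def V_def)
  have "4 / \<delta> \<le> n" "w \<le> card V" "0 < n" using N unfolding n_def V_def by linarith+
  then have dn: "4 \<le> \<delta> * n" using delta01 by (simp add: field_simps)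
  let ?bad = "\<lambda>W. bad E W (\<delta> * n) (\<epsilon> / 4 * n) (2 * J)"
  have "\<exists>W \<subseteq> V. \<delta> * n < real (card (?bad W))"
  proof (rule ccontr)
    assume "\<not> ?thesis"
    then have few: "\<And>W. W \<subseteq> V \<Longrightarrow> real (card (?bad W)) \<le> \<delta> * n" by (simp add: not_less)
    \<comment> \<open>The 200 in \<open>\<delta>\<close> is large enough for
      \<open>46 / 200 \<le> 1 / 4\<close>.\<close>
    have "(2 * real J + 1) * \<delta> / (\<epsilon> / 4) + 2 * \<delta> = (4 * ((2 * real J + 1) * \<epsilon>) + 2 * \<epsilon> ^ 2) * \<epsilon> / 200"
      using eps by (simp add: delta field_simps power2_eq_square power3_eq_cube)
    also have "\<dots> \<le> (4 * 11 + 2 * 1) * \<epsilon> / 200"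
      using eps J(2) by (intro divide_right_mono mult_right_mono add_mono mult_left_mono) (auto simp: power_le_one)
    also have "\<dots> \<le> \<epsilon> / 4" using eps by simp
    finally have "((2 * real J + 1) * \<delta> / (\<epsilon> / 4) + 2 * \<delta>) * n \<le> \<epsilon> / 4 * n"
      using \<open>0 < n\<close> by (intro mult_right_mono) auto
    then have small: "(2 * real J + 1) * (\<delta> * n) / (\<epsilon> / 4) + 2 * (\<delta> * n) \<le> \<epsilon> / 4 * n"
      by (simp add: algebra_simps)
    have J': "4 < \<epsilon> / 4 * (real J + 1) ^ 2" using J(1) by simp
    obtain D and col :: "nat \<Rightarrow> bool" where D: "finite D" "real (card D) \<le> 2 * (\<epsilon> / 4) * n * real (card V)"
      and col: "\<And>u x. u \<in> V \<Longrightarrow> x \<in> V \<Longrightarrow> {u, x} \<in> E \<Longrightarrow> {u, x} \<notin> D \<Longrightarrow> col u \<noteq> col x"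
      using near_bipartite[OF finV _ \<open>0 < n\<close> _ _ J' small few order.refl] delta01 eps \<open>0 < n\<close> by (auto simp: n_def)
    have sG: "simple_graph (remove_edges G (D \<inter> E))" using G by (auto simp: simple_graph_def remove_edges_def)
    have "remove_edges G (D \<inter> E) \<in> slow_odd_girth g"
    proof (rule two_coloured_in_slow_odd_girth[OF sG])
      fix u x assume "{u, x} \<in> edges (remove_edges G (D \<inter> E))"
      then have "{u, x} \<in> E" "{u, x} \<notin> D" by (auto simp: remove_edges_def E_def)
      moreover then have "{u, x} \<subseteq> V" using G by (auto simp: simple_graph_def V_def E_def)
      ultimately show "col u \<noteq> col x" using col by simp
    qed
    then have "\<epsilon> * n ^ 2 \<le> real (card (D \<inter> E))"
      using far by (auto simp: eps_far_def E_def n_def V_def)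
    also have "\<dots> \<le> real (card D)" using D(1) by (intro of_nat_mono card_mono) auto
    also have "\<dots> \<le> \<epsilon> / 2 * n ^ 2" using D(2) by (simp add: n_def power2_eq_square)
    finally show False using eps \<open>0 < n\<close> by simp
  qed
  then obtain W where W: "W \<subseteq> V" "\<delta> * n \<le> real (card (?bad W))" by force
  let ?walk = "{S. S \<subseteq> V \<and> card S = w \<and> (\<exists>i v. i \<le> 2 * J \<and> (v, v) \<in> arcs {e \<in> E. e \<subseteq> S} ^^ (2 * i + 1))}"
  let ?rej = "{S. S \<subseteq> V \<and> card S = w \<and> induced_subgraph G S \<notin> slow_odd_girth g}"
  have "2 / 3 * real (card V choose w) \<le> real (card ?walk)"
    using W(2) w dn \<open>w \<le> card V\<close> delta01
    by (intro odd_walk_in_most_samples[OF W(1) finV refl]) (simp_all add: n_def)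
  also have "\<dots> \<le> real (card ?rej)"
  proof (intro of_nat_mono card_mono subsetI)
    show "finite ?rej" by (rule finite_subset[of _ "Pow V"]) (use finV in auto)
    fix S assume "S \<in> ?walk"
    then obtain i v where S: "S \<subseteq> V" "card S = w" "i \<le> 2 * J" "(v, v) \<in> arcs {e \<in> E. e \<subseteq> S} ^^ (2 * i + 1)"
      by blast
    have "induced_subgraph G S \<notin> slow_odd_girth g"
    proof
      assume "induced_subgraph G S \<in> slow_odd_girth g"
      then have "\<forall>k v. odd k \<longrightarrow> g k \<le> card S \<longrightarrow> (v, v) \<notin> arcs {e \<in> E. e \<subseteq> S} ^^ k"
        by (simp add: slow_odd_girth_def induced_subgraph_def E_def)
      moreover have "odd (2 * i + 1)" by simp
      ultimately show False using S g by blast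
    qed
    then show "S \<in> ?rej" using S by blast
  qed
  finally have "2 / 3 * real (card V choose w) \<le> real (card ?rej)" .
  moreover have "0 < card V choose w" using \<open>w \<le> card V\<close> by simp
  ultimately show "2 / 3 \<le> rejection_prob (slow_odd_girth g) G w"
    using \<open>w \<le> card V\<close> by (simp add: rejection_prob_eq[OF G] V_def le_divide_eq)
qed

section \<open>Choice of parameters and the two bounds\<close>

lemma witness_size_le:
  assumes "0 < w" "sample_size_suffices P \<epsilon> w"
  shows "witness_size P \<epsilon> \<le> w"
  unfolding witness_size_def using assms by (intro Least_le) simp

lemma sample_size_suffices_witness_size:
  assumes "0 < w" "sample_size_suffices P \<epsilon> w"
  shows "sample_size_suffices P \<epsilon> (witness_size P \<epsilon>)"
  unfolding witness_size_def
  using LeastI[of "\<lambda>w. 0 < w \<and> sample_size_suffices P \<epsilon> w" w] assms by simp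

text \<open>\<open>J\<close> is \<open>4 / sqrt \<epsilon>\<close> rounded up. The four bounds serve
  the thin boundary, the number of deletions, the longest walk (length \<open>4 * J + 1\<close>) and
  the sample size.\<close>

lemma radius_exists:
  fixes \<epsilon> :: real
  assumes "0 < \<epsilon>" "\<epsilon> < 1"
  obtains J :: nat where "16 < \<epsilon> * (real J + 1) ^ 2" "(2 * real J + 1) * \<epsilon> \<le> 11"
    "\<epsilon> * (4 * real J + 3) ^ 2 \<le> 529" "real (12 * J + 7) * \<epsilon> \<le> 67"
proof -
  define s where "s = sqrt \<epsilon>"
  have s: "0 < s" "s < 1" "s * s = \<epsilon>" using assms by (auto simp: s_def)
  define J where "J = nat \<lceil>4 / s\<rceil>"
  have J: "4 / s \<le> real J" "real J \<le> 4 / s + 1"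
    using s(1) by (auto simp: J_def)
  have Js: "4 \<le> s * real J" "s * real J \<le> 5" using J s by (auto simp: field_simps)
  have "4 ^ 2 < (s * (real J + 1)) ^ 2" using Js s by (intro power_strict_mono) (auto simp: algebra_simps)
  then have 1: "16 < \<epsilon> * (real J + 1) ^ 2" by (simp add: s(3)[symmetric] power2_eq_square mult_ac)
  have "(s * (4 * real J + 3)) ^ 2 \<le> 23 ^ 2" using Js s by (intro power_mono) (auto simp: algebra_simps)
  then have 3: "\<epsilon> * (4 * real J + 3) ^ 2 \<le> 529" by (simp add: s(3)[symmetric] power2_eq_square mult_ac)
  have "s * (s * real J) \<le> 1 * 5" using Js s by (intro mult_mono) auto
  then have "\<epsilon> * real J \<le> 5" by (simp add: s(3)[symmetric] mult_ac)
  then have "(2 * real J + 1) * \<epsilon> \<le> 11" "real (12 * J + 7) * \<epsilon> \<le> 67" using assms by (simp_all add: algebra_simps)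
  with 1 3 show ?thesis using that by blast
qed

text \<open>The lower bound stops at 1/4: any graph becomes bipartite on losing at most half of its
  edges, so for larger \<epsilon> no nonempty graph is far from the property used here, and its
  witness size is 1. The condition \<open>c \<ge> 1\<close> keeps \<open>\<epsilon> / c\<close> in
  the domain of \<open>f\<close>.\<close>

theorem theorem2:
  "\<exists>c::real. c \<ge> 1 \<and>
     (\<forall>f :: real \<Rightarrow> nat.
        antimono_on {0<..<1} f \<longrightarrow> (\<forall>x\<in>{0<..<1}. real (f x) \<ge> 1 / x) \<longrightarrow>
        (\<exists>P. monotone_graph_property P \<and>
           (\<forall>\<epsilon>\<in>{0<..<1/4}. f \<epsilon> \<le> witness_size P \<epsilon>) \<and>
           (\<forall>\<epsilon>\<in>{0<..<1}. real (witness_size P \<epsilon>) \<le> \<epsilon> powr (-14) * real (f (\<epsilon> / c)))))"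
proof -
  \<comment> \<open>Inserting \<open>\<delta> = \<epsilon>^3 / 200\<close> and
    \<open>12 * J + 7 \<le> 67 / \<epsilon>\<close> into the sample size gives
    \<open>c0 / \<epsilon>^10\<close>; the extra 1 in \<open>c\<close> pays for rounding up.\<close>
  define c0 c :: real where "c0 = 2592 * 67 * 200 ^ 3" and "c = c0 + 1"
  have c: "529 \<le> c" "1 \<le> c" by (simp_all add: c_def c0_def)
  have "\<exists>P. monotone_graph_property P \<and>
           (\<forall>\<epsilon>\<in>{0<..<1/4}. f \<epsilon> \<le> witness_size P \<epsilon>) \<and>
           (\<forall>\<epsilon>\<in>{0<..<1}. real (witness_size P \<epsilon>) \<le> \<epsilon> powr (-14) * real (f (\<epsilon> / c)))"
    if anti: "antimono_on {0<..<1} f" and f_ge: "\<forall>x\<in>{0<..<1}. real (f x) \<ge> 1 / x" for f :: "real \<Rightarrow> nat"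
  proof -
    have f_mono: "f y \<le> f x" if "0 < x" "x \<le> y" "y < 1" for x y
      using monotone_onD[OF anti, of x y] that by simp
    \<comment> \<open>The shift by 2 reaches the next odd length, so
      \<open>f \<epsilon> \<le> g l\<close> on the whole interval served by \<open>l\<close>, and
      keeps the argument below 1 even for \<open>k = 0\<close>.\<close>
    define g where "g k = f (1 / (real k + 2) ^ 2)" for k
    let ?P = "slow_odd_girth g"
    have g_mono: "g i \<le> g j" if "i \<le> j" for i j
      unfolding g_def using that by (intro f_mono divide_left_mono power_mono) (auto simp: power_gt1)
    have upper: "\<exists>w. 0 < w \<and> sample_size_suffices ?P \<epsilon> w \<and> real w \<le> \<epsilon> powr (-14) * real (f (\<epsilon> / c))"
      if eps: "0 < \<epsilon>" "\<epsilon> < 1" for \<epsilon>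
    proof -
      obtain J :: nat where J: "16 < \<epsilon> * (real J + 1) ^ 2" "(2 * real J + 1) * \<epsilon> \<le> 11"
          "\<epsilon> * (4 * real J + 3) ^ 2 \<le> 529" "real (12 * J + 7) * \<epsilon> \<le> 67"
        using radius_exists[OF eps] .
      define w where "w = max (f (\<epsilon> / c)) (nat \<lceil>c0 / \<epsilon> ^ 10\<rceil>)"
      have ec: "0 < \<epsilon> / c" "\<epsilon> / c < 1" using eps c by (auto simp: divide_less_eq)
      have pos: "0 < f (\<epsilon> / c)"
        using f_ge ec by (metis divide_pos_pos greaterThanLessThan_iff less_le_trans of_nat_0_less_iff zero_less_one)
      have big: "2592 * real (12 * J + 7) / (\<epsilon> ^ 3 / 200) ^ 3 \<le> real w"
      proof -
        have "2592 * real (12 * J + 7) / (\<epsilon> ^ 3 / 200) ^ 3 = (real (12 * J + 7) * \<epsilon>) * (2592 * 200 ^ 3 / \<epsilon> ^ 10)"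
          using eps by (simp add: power_divide field_simps eval_nat_numeral)
        also have "\<dots> \<le> 67 * (2592 * 200 ^ 3 / \<epsilon> ^ 10)"
          using J(4) eps by (intro mult_right_mono) auto
        also have "\<dots> = c0 / \<epsilon> ^ 10" by (simp add: c0_def)
        also have "\<dots> \<le> real w" by (simp add: w_def) linarith
        finally show ?thesis .
      qed
      have "g (2 * i + 1) \<le> w" if "i \<le> 2 * J" for i
      proof -
        have "\<epsilon> * (real (2 * i + 1) + 2) ^ 2 \<le> \<epsilon> * (4 * real J + 3) ^ 2"
          using that eps by (intro mult_left_mono power_mono) auto
        also have "\<dots> \<le> c" using J(3) c by linarith
        finally have "\<epsilon> / c \<le> 1 / (real (2 * i + 1) + 2) ^ 2" using c by (simp add: field_simps)
        then have "g (2 * i + 1) \<le> f (\<epsilon> / c)"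
          unfolding g_def using ec by (intro f_mono) (auto simp: power_gt1)
        then show ?thesis by (simp add: w_def)
      qed
      then have "sample_size_suffices ?P \<epsilon> w"
        using J big eps by (intro sample_size_suffices_slow_odd_girth[where J = J]) auto
      moreover have "real w \<le> \<epsilon> powr (-14) * real (f (\<epsilon> / c))"
      proof -
        have powr: "\<epsilon> powr (-14) = 1 / \<epsilon> ^ 14"
          using eps powr_minus[of \<epsilon> 14] by (simp add: powr_numeral inverse_eq_divide)
        have p1: "1 \<le> 1 / \<epsilon> ^ k" for k using eps by (simp add: power_le_one)
        have "real (f (\<epsilon> / c)) \<le> 1 / \<epsilon> ^ 14 * real (f (\<epsilon> / c))"
          using mult_right_mono[OF p1, of "real (f (\<epsilon> / c))" 14] by simp
        moreover have "real (nat \<lceil>c0 / \<epsilon> ^ 10\<rceil>) \<le> 1 / \<epsilon> ^ 14 * real (f (\<epsilon> / c))"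
        proof -
          have "real (nat \<lceil>c0 / \<epsilon> ^ 10\<rceil>) \<le> c0 * (1 / \<epsilon> ^ 10) + 1 / \<epsilon> ^ 10"
          proof -
            have "0 \<le> c0 / \<epsilon> ^ 10" using eps by (simp add: c0_def)
            then have "real (nat \<lceil>c0 / \<epsilon> ^ 10\<rceil>) \<le> c0 / \<epsilon> ^ 10 + 1" by linarith
            then show ?thesis using p1[of 10] by simp
          qed
          also have "\<dots> = 1 / \<epsilon> ^ 10 * c" by (simp add: c_def algebra_simps add_divide_distrib)
          \<comment> \<open>Raising the exponent to 15 splits off the factor
            \<open>c / \<epsilon>\<close>, which \<open>f x \<ge> 1 / x\<close> at
            \<open>x = \<epsilon> / c\<close> turns into \<open>f (\<epsilon> / c)\<close>.\<close>
          also have "\<dots> \<le> 1 / \<epsilon> ^ 10 * c * (1 / \<epsilon> ^ 5)"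
            using mult_left_mono[OF p1[of 5], of "1 / \<epsilon> ^ 10 * c"] eps c by simp
          also have "\<dots> = 1 / \<epsilon> ^ 14 * (1 / (\<epsilon> / c))"
            using eps by (simp add: eval_nat_numeral)
          also have "\<dots> \<le> 1 / \<epsilon> ^ 14 * real (f (\<epsilon> / c))"
            using bspec[OF f_ge, of "\<epsilon> / c"] ec eps by (intro mult_left_mono) (simp_all only: greaterThanLessThan_iff, simp)
          finally show ?thesis .
        qed
        ultimately show ?thesis by (simp add: w_def powr)
      qed
      moreover have "0 < w" using pos by (simp add: w_def)
      ultimately show ?thesis by blast
    qed
    have lower: "f \<epsilon> \<le> w" if eps: "0 < \<epsilon>" "\<epsilon> < 1 / 4" and suff: "sample_size_suffices ?P \<epsilon> w" for \<epsilon> w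
    proof -
      obtain l where l: "1 / (real l + 2) ^ 2 \<le> \<epsilon>"
        and far: "\<And>N. \<exists>G. simple_graph G \<and> N \<le> card (verts G) \<and> eps_far \<epsilon> ?P G
          \<and> (\<forall>k v. odd k \<longrightarrow> k < l \<longrightarrow> (v, v) \<notin> arcs (edges G) ^^ k)"
      proof (cases "1 / 9 \<le> \<epsilon>")
        case True
        then show ?thesis using complete_graph_far[OF eps(2)] by (intro that[of 3]) auto
      next
        case False
        \<comment> \<open>A switch from false to true at \<open>q\<close> gives
          \<open>1 / (l + 2)^2 \<le> \<epsilon> < 1 / l^2\<close> for
          \<open>l = 2 * q + 3\<close>.\<close>
        define Q where "Q q \<longleftrightarrow> 1 \<le> \<epsilon> * (2 * real q + 3) ^ 2" for q
        have "Q (nat \<lceil>1 / \<epsilon>\<rceil>)"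
        proof -
          let ?m = "real (nat \<lceil>1 / \<epsilon>\<rceil>)"
          have "\<epsilon> * (1 / \<epsilon>) \<le> \<epsilon> * ?m" using eps by (intro mult_left_mono real_nat_ceiling_ge) auto
          then have m: "1 \<le> \<epsilon> * ?m" using eps by simp
          have "?m * 1 \<le> (2 * ?m + 3) * (2 * ?m + 3)" by (intro mult_mono) auto
          then have "\<epsilon> * ?m \<le> \<epsilon> * (2 * ?m + 3) ^ 2" using eps by (simp add: power2_eq_square)
          then show ?thesis using m by (simp add: Q_def)
        qed
        moreover have "\<not> Q 0" using False by (simp add: Q_def)
        ultimately obtain q where q: "\<not> Q q" "Q (Suc q)"
          using ex_least_nat_less[of Q] by (metis Suc_le_eq lessI order_refl)
        let ?l = "2 * q + 3"
        have "\<epsilon> * real ?l ^ 2 \<le> 1" using q(1) by (simp add: Q_def)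
        moreover have "1 / (real ?l + 2) ^ 2 \<le> \<epsilon>"
          using q(2) by (simp add: Q_def divide_le_eq algebra_simps)
        ultimately show ?thesis using that[of ?l] cycle_blowup_far[of ?l \<epsilon>] by auto
      qed
      have "f \<epsilon> \<le> g l"
        unfolding g_def using l eps by (intro f_mono) auto
      moreover have "\<not> w < g l"
        using not_sample_size_suffices[OF g_mono _ far] suff by blast
      ultimately show ?thesis by linarith
    qed
    have "f \<epsilon> \<le> witness_size ?P \<epsilon>" if eps: "0 < \<epsilon>" "\<epsilon> < 1 / 4" for \<epsilon>
    proof -
      have "\<epsilon> < 1" using eps by simp
      \<comment> \<open>Some sample size suffices, so the \<open>LEAST\<close> in
        \<open>witness_size\<close> is attained and \<open>lower\<close> applies to it.\<close>
      from upper[OF eps(1) this] obtain w where "0 < w" "sample_size_suffices ?P \<epsilon> w" by blast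
      then show ?thesis using lower[OF eps] sample_size_suffices_witness_size by blast
    qed
    moreover have "real (witness_size ?P \<epsilon>) \<le> \<epsilon> powr (-14) * real (f (\<epsilon> / c))" if eps: "0 < \<epsilon>" "\<epsilon> < 1" for \<epsilon>
    proof -
      obtain w where w: "0 < w" "sample_size_suffices ?P \<epsilon> w" "real w \<le> \<epsilon> powr (-14) * real (f (\<epsilon> / c))"
        using upper[OF eps] by blast
      have "real (witness_size ?P \<epsilon>) \<le> real w" using witness_size_le[OF w(1,2)] by simp
      then show ?thesis using w(3) by linarith
    qed
    ultimately show ?thesis using monotone_slow_odd_girth[of g] by (intro exI[of _ ?P]) auto
  qed
  then show ?thesis using c(2) by blast
qed

end
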